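(* Let $p$ be an odd prime, $V$ a $2n$-dimensional vector space over $\mathbf F_p$ ($n\ge1$), and $f\colon V\times V\to\mathbf F_p$ a nondegenerate alternating form. Let $\rho\colon E(f)\to\mathrm{GL}(V')$ be an absolutely irreducible representation of degree $p^n$ over a field $K'$, with $\rho(0,1)=\epsilon\cdot 1$, and let $\sigma$ be the associated factor set on $G(f)$. For $g\in G(f)$ define $$\mu(g)=|I(g)|^{-1}\theta^{i(g)}\delta_g\in K'.$$ Then $\mu$ splits $\sigma$, i.e. $\sigma(g,h)=\mu(g)\mu(h)\mu(gh)^{-1}$ for all $g,h\in G(f)$. Furthermore, if $K'$ has an automorphism $\eta'$ inverting $\epsilon$, then $\mu(g)=\mu(g^{-1})^{\eta'}$ for all $g\in G(f)$.
   Context: Linear maps act on the right. $E(f)$ is the extraspecial group $V\times\mathbf F_p$ with multiplication $(x_1,z_1)(x_2,z_2)=(x_1+x_2,z_1+z_2+f(x_1,x_2))$. $G(f)$ is the group of all $g\in\mathrm{GL}(V)$ with $f(xg,yg)=f(x,y)$ for all $x,y\in V$ (the symplectic group). The central element $(0,1)$ of $E(f)$ acts under $\rho$ as a scalar $\epsilon\in K'$ which is a primitive $p$-th root of unity (so the characteristic of $K'$ is not $p$). For $g\in G(f)$, $I(g)$ is the image of $1-g$ on $V$ and $i(g)=\dim I(g)$. The bilinear form $f_g$ on $I(g)$ is defined by $f_g(x,y)=f(u,y)$ for any $u\in V$ with $x=u(1-g)$ (well defined). For nonzero $t\in\mathbf F_p$, $\chi(t)=1$ if $t$ is a square and $-1$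 otherwise; $\delta_g=\chi(\det M)$ where $M$ is the matrix of $f_g$ relative to any basis of $I(g)$ (so $\delta_1=1$). $\theta=\sum_{a\in\mathbf F_p}\epsilon^{a^2}\in K'$. For $g\in G(f)$ define $$s(g)=|V|^{-1}\sum_{y\in V}\rho(y,0)\rho(yg,0)^{-1};$$ each $s(g)$ is invertible, and the factor set $\sigma\colon G(f)\times G(f)\to K'\setminus\{0\}$ is defined by $s(g)s(h)=\sigma(g,h)s(gh)$. *)

theory Defs
  imports
    Berlekamp_Zassenhaus.Finite_Field
    Jordan_Normal_Form.Determinant
    Jordan_Normal_Form.VS_Connect
    "HOL-Algebra.Algebraic_Closure_Type"
begin

text \<open>
  The field with \<open>p\<close> elements is \<open>'p mod_ring\<close>, where \<open>'p :: prime_card\<close> and \<open>p = CARD('p)\<close>.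
  Vector spaces are carried by whole types, with an explicit scalar multiplication.
  Linear maps act on the right: a map \<open>T\<close> sends \<open>x\<close> to \<open>xT = T x\<close>, so the product \<open>ST\<close>
  (first \<open>S\<close>, then \<open>T\<close>) is \<open>T \<circ> S\<close>.
\<close>

definition GL :: "('k::field \<Rightarrow> 'v::ab_group_add \<Rightarrow> 'v) \<Rightarrow> ('v \<Rightarrow> 'v) monoid" where
  "GL scale = \<lparr>carrier = {T. Vector_Spaces.linear scale scale T \<and> bij T},
               monoid.mult = (\<lambda>S T. T \<circ> S), one = id\<rparr>"

definition ordered_basis ::
    "('k::field \<Rightarrow> 'v::ab_group_add \<Rightarrow> 'v) \<Rightarrow> 'v set \<Rightarrow> 'v list \<Rightarrow> bool" where
  "ordered_basis scale U bs \<longleftrightarrow>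
     distinct bs \<and> \<not> Modules.module.dependent scale (set bs) \<and> Modules.module.span scale (set bs) = U"


subsection \<open>Absolutely irreducible representations\<close>

text \<open>
  Column \<open>j\<close> of the matrix holds the coordinates of the image of the \<open>j\<close>-th basis vector, so
  the matrix times the coordinate column of \<open>v\<close> is the coordinate column of \<open>T v\<close>.
\<close>

definition matrix_of ::
    "('k::field \<Rightarrow> 'v::ab_group_add \<Rightarrow> 'v) \<Rightarrow> 'v list \<Rightarrow> ('v \<Rightarrow> 'v) \<Rightarrow> 'k mat" where
  "matrix_of scale bs T = Matrix.mat (length bs) (length bs)
     (\<lambda>(i, j). Modules.module.representation scale (set bs) (T (bs ! j)) (bs ! i))"

definition irreducible_matrices :: "nat \<Rightarrow> 'l::field mat set \<Rightarrow> bool" where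
  "irreducible_matrices m S \<longleftrightarrow> m > 0 \<and>
     (\<forall>W. VectorSpace.subspace class_ring W (module_vec TYPE('l) m) \<and>
          (\<forall>A\<in>S. \<forall>w\<in>W. A *\<^sub>v w \<in> W) \<longrightarrow>
          W = {0\<^sub>v m} \<or> W = carrier_vec m)"

text \<open>
  Absolute irreducibility is irreducibility after extending the scalars to the algebraic closure.
  The extension of scalars of a space with basis \<open>b\<^sub>1, \<dots>, b\<^sub>m\<close> is the space of
  columns of length \<open>m\<close> over the closure, on which a linear map acts by its matrix.
  Whether the condition holds does not depend on the basis.
\<close>

definition absolutely_irreducible ::
    "('k::field \<Rightarrow> 'w::ab_group_add \<Rightarrow> 'w) \<Rightarrow> ('g, 'b) monoid_scheme \<Rightarrow> ('g \<Rightarrow> 'w \<Rightarrow> 'w) \<Rightarrow> bool" where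
  "absolutely_irreducible scale E \<rho> \<longleftrightarrow>
     (\<exists>bs. ordered_basis scale UNIV bs \<and>
        irreducible_matrices (length bs)
          ((\<lambda>x. map_mat to_ac (matrix_of scale bs (\<rho> x))) ` carrier E))"


subsection \<open>The symplectic group and the extraspecial group\<close>

definition symplectic_form ::
    "('k::field \<Rightarrow> 'v::ab_group_add \<Rightarrow> 'v) \<Rightarrow> ('v \<Rightarrow> 'v \<Rightarrow> 'k) \<Rightarrow> bool" where
  "symplectic_form scale f \<longleftrightarrow>
     (\<forall>x. Vector_Spaces.linear scale (*) (f x)) \<and>
     (\<forall>y. Vector_Spaces.linear scale (*) (\<lambda>x. f x y)) \<and>
     (\<forall>x. f x x = 0) \<and>
     (\<forall>x. (\<forall>y. f x y = 0) \<longrightarrow> x = 0)"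

definition Sp ::
    "('k::field \<Rightarrow> 'v::ab_group_add \<Rightarrow> 'v) \<Rightarrow> ('v \<Rightarrow> 'v \<Rightarrow> 'k) \<Rightarrow> ('v \<Rightarrow> 'v) monoid" where
  "Sp scale f =
     (GL scale)\<lparr>carrier := {g \<in> carrier (GL scale). \<forall>x y. f (g x) (g y) = f x y}\<rparr>"

definition extraspecial ::
    "('v::ab_group_add \<Rightarrow> 'v \<Rightarrow> 'k::field) \<Rightarrow> ('v \<times> 'k) monoid" where
  "extraspecial f = \<lparr>carrier = UNIV,
     monoid.mult = (\<lambda>(x\<^sub>1, z\<^sub>1) (x\<^sub>2, z\<^sub>2). (x\<^sub>1 + x\<^sub>2, z\<^sub>1 + z\<^sub>2 + f x\<^sub>1 x\<^sub>2)),
     one = (0, 0)\<rparr>"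


subsection \<open>The operators \<open>s(g)\<close> and their factor set\<close>

definition s_op ::
    "('k::field \<Rightarrow> 'w::ab_group_add \<Rightarrow> 'w) \<Rightarrow> ('v::ab_group_add \<times> 'f::field \<Rightarrow> 'w \<Rightarrow> 'w)
     \<Rightarrow> ('v \<Rightarrow> 'v) \<Rightarrow> 'w \<Rightarrow> 'w" where
  "s_op scaleW \<rho> g = (\<lambda>w. scaleW (inverse (of_nat CARD('v)))
     (\<Sum>y\<in>UNIV. (\<rho> (y, 0) \<otimes>\<^bsub>GL scaleW\<^esub> inv\<^bsub>GL scaleW\<^esub> \<rho> (g y, 0)) w))"

text \<open>The scalar \<open>c\<close> with \<open>s(g)s(h) = c s(gh)\<close>; recall that products are read from left to right.\<close>

definition factor_set ::
    "('k::field \<Rightarrow> 'w::ab_group_add \<Rightarrow> 'w) \<Rightarrow> ('v::ab_group_add \<times> 'f::field \<Rightarrow> 'w \<Rightarrow> 'w)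
     \<Rightarrow> ('v \<Rightarrow> 'v) \<Rightarrow> ('v \<Rightarrow> 'v) \<Rightarrow> 'k" where
  "factor_set scaleW \<rho> g h = (THE c. c \<noteq> 0 \<and>
     s_op scaleW \<rho> h \<circ> s_op scaleW \<rho> g = (\<lambda>w. scaleW c (s_op scaleW \<rho> (h \<circ> g) w)))"

text \<open>The condition \<open>\<mu> g \<noteq> 0\<close> is stated because \<open>inverse 0 = 0\<close>.\<close>

definition splits ::
    "('g, 'b) monoid_scheme \<Rightarrow> ('g \<Rightarrow> 'k::field) \<Rightarrow> ('g \<Rightarrow> 'g \<Rightarrow> 'k) \<Rightarrow> bool" where
  "splits G \<mu> \<sigma> \<longleftrightarrow>
     (\<forall>g\<in>carrier G. \<mu> g \<noteq> 0) \<and>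
     (\<forall>g\<in>carrier G. \<forall>h\<in>carrier G. \<sigma> g h = \<mu> g * \<mu> h * inverse (\<mu> (g \<otimes>\<^bsub>G\<^esub> h)))"


subsection \<open>The splitting function\<close>

definition I_space :: "('v::ab_group_add \<Rightarrow> 'v) \<Rightarrow> 'v set" where
  "I_space g = range (\<lambda>u. u - g u)"

text \<open>The value does not depend on the choice of \<open>u\<close> as long as \<open>g\<close> preserves \<open>f\<close> and \<open>x, y \<in> I_space g\<close>.\<close>

definition I_form :: "('v::ab_group_add \<Rightarrow> 'v \<Rightarrow> 'k) \<Rightarrow> ('v \<Rightarrow> 'v) \<Rightarrow> 'v \<Rightarrow> 'v \<Rightarrow> 'k" where
  "I_form f g x y = f (SOME u. x = u - g u) y"

definition quadratic_char :: "'k::field \<Rightarrow> int" where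
  "quadratic_char t = (if \<exists>u. t = u\<^sup>2 then 1 else -1)"

text \<open>Another basis changes the determinant by a nonzero square.\<close>

definition I_disc ::
    "('k::field \<Rightarrow> 'v::ab_group_add \<Rightarrow> 'v) \<Rightarrow> ('v \<Rightarrow> 'v \<Rightarrow> 'k) \<Rightarrow> ('v \<Rightarrow> 'v) \<Rightarrow> int" where
  "I_disc scale f g =
     (let bs = (SOME bs. ordered_basis scale (I_space g) bs)
      in quadratic_char (Determinant.det (Matrix.mat (length bs) (length bs)
           (\<lambda>(i, j). I_form f g (bs ! i) (bs ! j)))))"

text \<open>
  The exponent of \<open>\<epsilon>\<close> is the representative of \<open>a\<^sup>2\<close> in \<open>{0..<p}\<close>.
\<close>

definition gauss_sum :: "'p::prime_card itself \<Rightarrow> 'k::field \<Rightarrow> 'k" where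
  "gauss_sum _ \<epsilon> = (\<Sum>a\<in>(UNIV :: 'p mod_ring set). \<epsilon> ^ nat (to_int_mod_ring (a\<^sup>2)))"

definition \<mu>_fun ::
    "('p::prime_card mod_ring \<Rightarrow> 'v::ab_group_add \<Rightarrow> 'v) \<Rightarrow> ('v \<Rightarrow> 'v \<Rightarrow> 'p mod_ring)
     \<Rightarrow> 'k::field \<Rightarrow> ('v \<Rightarrow> 'v) \<Rightarrow> 'k" where
  "\<mu>_fun scale f \<epsilon> g =
     inverse (of_nat (card (I_space g)))
     * gauss_sum TYPE('p) \<epsilon> ^ vector_space.dim scale (I_space g)
     * of_int (I_disc scale f g)"

definition primitive_root_of_unity :: "nat \<Rightarrow> 'k::field \<Rightarrow> bool" where
  "primitive_root_of_unity m \<epsilon> \<longleftrightarrow> \<epsilon> ^ m = 1 \<and> (\<forall>k. 0 < k \<and> k < m \<longrightarrow> \<epsilon> ^ k \<noteq> 1)"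

end

theory Submission
  imports Defs
begin

text \<open>
  Write \<open>Q\<^sub>g(x) = f\<^sub>g(x, x)\<close>. Summing over the fibres of \<open>1 - g\<close> gives
  \<open>s(g) = |I(g)|\<^sup>-\<^sup>1 \<Sum> \<epsilon>^Q\<^sub>g(x) \<rho>(x, 0)\<close>, the sum being over \<open>x \<in> I(g)\<close>, so the claim is that
  \<open>S(g) = s(g) / \<mu>(g)\<close> is multiplicative. As transvections generate the symplectic group, it suffices
  to show \<open>S(g) S(t) = S(gt)\<close> for a transvection \<open>t\<close> with centre \<open>v\<close>, that is, with \<open>I(t)\<close> spanned
  by \<open>v\<close>. Put \<open>b = f\<^sub>t(v, v)\<close>.

  If \<open>v \<notin> I(g)\<close>, then \<open>I(gt) = I(g) \<oplus> \<langle>v\<rangle>\<close> and \<open>f\<^sub>g\<^sub>t\<close> is block triangular with blocks \<open>f\<^sub>g\<close> and \<open>b\<close>.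
  If \<open>v \<in> I(g)\<close>, the coefficients of the product are Gauss sums of \<open>c \<mapsto> B c\<^sup>2 - 2 c f\<^sub>g(v, z)\<close> with
  \<open>B = Q\<^sub>g(v) + b\<close>. For \<open>B \<noteq> 0\<close>, \<open>f\<^sub>g\<^sub>t\<close> is a rank one perturbation of \<open>f\<^sub>g\<close> on the same space, and its
  determinant is that of \<open>f\<^sub>g\<close> times \<open>b / B\<close>. For \<open>B = 0\<close>, the first case applies to \<open>gt\<close> and \<open>t\<^sup>-\<^sup>1\<close>.
\<close>

section \<open>Quadratic residues and Gauss sums\<close>

text \<open>Each nonzero square has exactly two roots, \<open>r\<close> and \<open>- r\<close>,
  which differ because 2 is nonzero.\<close>

lemma sum_squares_finite_field:
  fixes h :: "'a::{field,finite} \<Rightarrow> 'b::comm_semiring_1"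
  assumes "(2::'a) \<noteq> 0"
  shows "(\<Sum>c\<in>UNIV - {0}. h (c\<^sup>2)) = 2 * sum h ((\<lambda>c. c\<^sup>2) ` (UNIV - {0}))"
proof -
  let ?S = "UNIV - {0::'a}"
  have fib: "(\<Sum>x\<in>{x\<in>?S. x\<^sup>2 = y}. h (x\<^sup>2)) = 2 * h y" if y: "y \<in> (\<lambda>c. c\<^sup>2) ` ?S" for y
  proof -
    obtain r where r: "r \<noteq> 0" "y = r\<^sup>2" using y by auto
    have ne: "r \<noteq> - r"
    proof
      assume "r = - r"
      hence "2 * r = 0" by (metis add.right_inverse mult_2)
      thus False using r assms by simp
    qed
    have "x\<^sup>2 = y \<longleftrightarrow> x = r \<or> x = - r" for x
      unfolding r by (rule power2_eq_iff)
    moreover have "- r \<noteq> 0" using r by simp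
    ultimately have "{x\<in>?S. x\<^sup>2 = y} = {r, - r}" using r(1) by auto
    moreover have "(\<Sum>x\<in>{r, - r}. h (x\<^sup>2)) = h y + h y"
      using ne r(2) by (subst sum.insert) auto
    ultimately show ?thesis by (simp only: mult_2)
  qed
  have "(\<Sum>c\<in>?S. h (c\<^sup>2)) = (\<Sum>y\<in>(\<lambda>c. c\<^sup>2) ` ?S. \<Sum>x\<in>{x\<in>?S. x\<^sup>2 = y}. h (x\<^sup>2))"
    by (rule sum.image_gen) simp
  also have "\<dots> = (\<Sum>y\<in>(\<lambda>c. c\<^sup>2) ` ?S. 2 * h y)"
    by (rule sum.cong[OF refl fib])
  finally show ?thesis by (simp add: sum_distrib_left)
qed

text \<open>Squaring is two-to-one, so \<open>S\<close> is half of the nonzero elements. Its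
  translate by \<open>b\<close> has the same size and is disjoint from it, as
  \<open>u\<^sup>2 = b * v\<^sup>2\<close> would make \<open>b\<close> a square.\<close>

lemma nonsquare_coset:
  fixes b :: "'a::{field,finite}"
  assumes two: "(2::'a) \<noteq> 0" and b: "\<And>u. b \<noteq> u\<^sup>2"
  defines "S \<equiv> (\<lambda>c::'a. c\<^sup>2) ` (UNIV - {0})"
  shows "S \<union> (*) b ` S = UNIV - {0}" and "S \<inter> (*) b ` S = {}"
proof -
  have b0: "b \<noteq> 0" using b[of 0] by auto
  show disj: "S \<inter> (*) b ` S = {}"
  proof (rule ccontr)
    assume "S \<inter> (*) b ` S \<noteq> {}"
    then obtain u v where uv: "v \<noteq> 0" "u\<^sup>2 = b * v\<^sup>2" by (auto simp: S_def)
    hence "b = (u / v)\<^sup>2" by (simp add: power_divide)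
    thus False using b by blast
  qed
  have card_S: "card (UNIV - {0::'a}) = 2 * card S"
    using sum_squares_finite_field[OF two, of "\<lambda>_. 1::nat"] by (simp add: S_def)
  have fin: "finite S" by simp
  have "card ((*) b ` S) = card S"
    by (rule card_image) (use b0 in \<open>auto simp: inj_on_def\<close>)
  hence "card (S \<union> (*) b ` S) = card (UNIV - {0::'a})"
    using card_S disj fin by (simp add: card_Un_disjoint)
  moreover have "S \<union> (*) b ` S \<subseteq> UNIV - {0}" using b0 by (auto simp: S_def)
  ultimately show "S \<union> (*) b ` S = UNIV - {0}"
    by (intro card_subset_eq) auto
qed

lemma quadratic_char_square [simp]: "quadratic_char (u\<^sup>2) = 1"
  by (auto simp: quadratic_char_def)

lemma quadratic_char_1 [simp]: "quadratic_char 1 = 1"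
  using quadratic_char_square[of 1] by simp

lemma quadratic_char_times_self [simp]: "quadratic_char t * quadratic_char t = 1"
  by (simp add: quadratic_char_def)

lemma quadratic_char_square_mult:
  assumes "s \<noteq> 0"
  shows "quadratic_char (s\<^sup>2 * t) = quadratic_char t"
proof -
  have "(\<exists>u. s\<^sup>2 * t = u\<^sup>2) \<longleftrightarrow> (\<exists>u. t = u\<^sup>2)"
  proof
    assume "\<exists>u. s\<^sup>2 * t = u\<^sup>2"
    then obtain u where "s\<^sup>2 * t = u\<^sup>2" ..
    hence "t = (u / s)\<^sup>2" using assms by (simp add: power_divide field_simps)
    thus "\<exists>u. t = u\<^sup>2" ..
  qed (metis power_mult_distrib)
  thus ?thesis by (simp add: quadratic_char_def)
qed

text \<open>The case of interest is two nonsquares: then \<open>a\<close> lies in the coset of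
  \<open>b\<close>, and \<open>a = b * u\<^sup>2\<close> makes the product a square. Zero is
  excluded since \<open>quadratic_char 0 = 1\<close>.\<close>

lemma quadratic_char_mult:
  fixes a b :: "'a::{field,finite}"
  assumes two: "(2::'a) \<noteq> 0" and a: "a \<noteq> 0" and b: "b \<noteq> 0"
  shows "quadratic_char (a * b) = quadratic_char a * quadratic_char b"
proof (cases "\<exists>u. b = u\<^sup>2")
  case True
  then obtain u where "b = u\<^sup>2" ..
  thus ?thesis using b quadratic_char_square_mult[of u a] by (simp add: mult.commute)
next
  case False
  let ?S = "(\<lambda>c::'a. c\<^sup>2) ` (UNIV - {0})"
  have cover: "?S \<union> (*) b ` ?S = UNIV - {0}" and disj: "?S \<inter> (*) b ` ?S = {}"
    using nonsquare_coset[OF two, of b] False by auto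
  show ?thesis
  proof (cases "\<exists>u. a = u\<^sup>2")
    case True
    then obtain u where "a = u\<^sup>2" ..
    thus ?thesis using a quadratic_char_square_mult[of u b] by simp
  next
    case nsq: False
    have "a \<in> (*) b ` ?S" using cover nsq a by auto
    then obtain u where "a = b * u\<^sup>2" by auto
    hence "a * b = (b * u)\<^sup>2" by (simp add: power2_eq_square)
    hence "quadratic_char (a * b) = 1" by simp
    thus ?thesis using False nsq by (simp add: quadratic_char_def)
  qed
qed

lemma two_neq_zero_mod_ring:
  assumes "odd CARD('p::prime_card)"
  shows "(2 :: 'p mod_ring) \<noteq> 0"
proof -
  have "CARD('p) > 2" using assms prime_card[where 'a='p]
    by (metis dvd_refl le_neq_implies_less prime_ge_2_nat)
  hence "to_int_mod_ring (of_int_mod_ring 2 :: 'p mod_ring) = 2" by simp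
  thus ?thesis
    by (metis of_int_numeral of_int_of_int_mod_ring to_int_mod_ring_hom.hom_zero zero_neq_numeral)
qed

section \<open>The additive character of the prime field and its Gauss sums\<close>

locale primitive_character =
  fixes \<epsilon> :: "'k::field" and p :: "'p::prime_card itself"
  assumes prim: "primitive_root_of_unity CARD('p) \<epsilon>" and odd_p: "odd CARD('p)"
begin

definition e :: "'p mod_ring \<Rightarrow> 'k" where
  "e a = \<epsilon> ^ nat (to_int_mod_ring a)"

definition \<theta> :: 'k where
  "\<theta> = gauss_sum TYPE('p) \<epsilon>"

lemma two_neq_0 [simp]: "(2 :: 'p mod_ring) \<noteq> 0"
  by (rule two_neq_zero_mod_ring[OF odd_p])

lemma eps_power: "\<epsilon> ^ CARD('p) = 1"
  using prim by (simp add: primitive_root_of_unity_def)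

lemma eps_nonzero: "\<epsilon> \<noteq> 0"
  using eps_power by (auto simp: power_0_left split: if_splits)

lemma e_0 [simp]: "e 0 = 1"
  by (simp add: e_def)

lemma e_1 [simp]: "e 1 = \<epsilon>"
  by (simp add: e_def)

lemma e_nonzero [simp]: "e a \<noteq> 0"
  by (simp add: e_def eps_nonzero)

lemma to_int_mod_ring_bounds: "0 \<le> to_int_mod_ring (a :: 'p mod_ring)" "to_int_mod_ring a < CARD('p)"
  using range_to_int_mod_ring[where 'a='p] by auto

lemma e_add: "e (a + b) = e a * e b"
proof -
  let ?a = "nat (to_int_mod_ring a)" and ?b = "nat (to_int_mod_ring b)"
  have "nat (to_int_mod_ring (a + b)) = (?a + ?b) mod CARD('p)"
    using to_int_mod_ring_bounds
    by (simp add: to_int_mod_ring_add nat_mod_distrib nat_add_distrib)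
  moreover have "\<epsilon> ^ (?a + ?b) = \<epsilon> ^ ((?a + ?b) mod CARD('p))"
  proof -
    have "\<epsilon> ^ n = \<epsilon> ^ (n mod CARD('p))" for n
    proof -
      have "\<epsilon> ^ n = \<epsilon> ^ (CARD('p) * (n div CARD('p)) + n mod CARD('p))" by simp
      also have "\<dots> = \<epsilon> ^ (n mod CARD('p))"
        by (simp only: power_add power_mult eps_power power_one mult_1)
      finally show ?thesis .
    qed
    thus ?thesis by blast
  qed
  ultimately show ?thesis by (simp add: e_def power_add)
qed

lemma e_minus: "e (- a) = inverse (e a)"
  using e_add[of a "- a"] by (simp add: inverse_unique)

lemma e_eq_1_iff: "e a = 1 \<longleftrightarrow> a = 0"
proof
  assume "e a = 1"
  hence "nat (to_int_mod_ring a) = 0"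
    using prim to_int_mod_ring_bounds[of a] unfolding primitive_root_of_unity_def e_def
    by (metis nat_less_iff not_gr_zero)
  hence "to_int_mod_ring a = 0" using to_int_mod_ring_bounds(1)[of a] by linarith
  thus "a = 0" by simp
qed simp

text \<open>In characteristic p the Frobenius map would give
  \<open>(\<epsilon> - 1) ^ p = \<epsilon> ^ p - 1 = 0\<close>, hence
  \<open>\<epsilon> = 1\<close>.\<close>

lemma of_nat_p_nonzero: "of_nat CARD('p) \<noteq> (0::'k)"
proof
  assume "of_nat CARD('p) = (0::'k)"
  hence "CHAR('k) dvd CARD('p)" by (simp add: of_nat_eq_0_iff_char_dvd)
  moreover have "CHAR('k) \<noteq> 1" using CHAR_not_1[where 'a='k] by simp
  ultimately have char: "CHAR('k) = CARD('p)"
    using prime_card[where 'a='p] by (meson prime_nat_iff)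
  have "(\<epsilon> - 1 + 1) ^ CARD('p) = (\<epsilon> - 1) ^ CARD('p) + 1 ^ CARD('p)"
    by (rule freshmans_dream) (simp_all only: char prime_card)
  hence "(\<epsilon> - 1) ^ CARD('p) = 0" using eps_power by simp
  hence "\<epsilon> = 1" by simp
  moreover have "\<epsilon> \<noteq> 1" using e_eq_1_iff[of 1] by simp
  ultimately show False by simp
qed

text \<open>Translating the summation variable by 1 multiplies the sum by
  \<open>e 1 = \<epsilon>\<close>, which is not 1.\<close>

lemma sum_e: "(\<Sum>a\<in>UNIV. e a) = 0"
proof -
  have "(\<Sum>a\<in>UNIV. e a) = (\<Sum>a\<in>UNIV. e (1 + a))"
    by (rule sum.reindex_bij_witness[of _ "\<lambda>a. 1 + a" "\<lambda>a. a - 1"]) auto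
  also have "\<dots> = e 1 * (\<Sum>a\<in>UNIV. e a)"
    by (simp only: e_add sum_distrib_left)
  finally have "(e 1 - 1) * (\<Sum>a\<in>UNIV. e a) = 0" by (simp add: algebra_simps)
  thus ?thesis using e_eq_1_iff[of 1] by auto
qed

lemma sum_e_mult: "(\<Sum>a\<in>UNIV. e (t * a)) = (if t = 0 then of_nat CARD('p) else 0)"
proof (cases "t = 0")
  case False
  have "(\<Sum>a\<in>UNIV. e (t * a)) = (\<Sum>a\<in>UNIV. e a)"
    by (rule sum.reindex_bij_witness[of _ "\<lambda>a. a / t" "\<lambda>a. t * a"]) (use False in auto)
  thus ?thesis using False sum_e by simp
next
  case True
  have "card (UNIV :: 'p mod_ring set) = CARD('p)" by simp
  thus ?thesis using True by simp
qed

lemma gauss_sum_eq: "\<theta> = (\<Sum>a\<in>UNIV. e (a\<^sup>2))"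
  by (simp add: \<theta>_def gauss_sum_def e_def)

text \<open>For a nonsquare \<open>b\<close>, the nonzero squares and their multiples by
  \<open>b\<close> together exhaust the nonzero elements. Adding the two Gauss sums gives twice the
  full character sum, which is 0.\<close>

lemma gauss_sum_scaled:
  assumes "b \<noteq> 0"
  shows "(\<Sum>a\<in>UNIV. e (b * a\<^sup>2)) = of_int (quadratic_char b) * \<theta>"
proof (cases "\<exists>u. b = u\<^sup>2")
  case True
  then obtain u where u: "b = u\<^sup>2" ..
  hence "u \<noteq> 0" using assms by auto
  have "(\<Sum>a\<in>UNIV. e (b * a\<^sup>2)) = (\<Sum>a\<in>UNIV. e (a\<^sup>2))"
    by (rule sum.reindex_bij_witness[of _ "\<lambda>a. a / u" "\<lambda>a. u * a"])
      (use \<open>u \<noteq> 0\<close> u in \<open>auto simp: power_mult_distrib\<close>)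
  thus ?thesis using u by (simp add: gauss_sum_eq)
next
  case False
  let ?S = "(\<lambda>c::'p mod_ring. c\<^sup>2) ` (UNIV - {0})"
  have cover: "?S \<union> (*) b ` ?S = UNIV - {0}" and disj: "?S \<inter> (*) b ` ?S = {}"
    using nonsquare_coset[OF two_neq_0, of b] False by auto
  have split: "(\<Sum>a\<in>UNIV. h a) = h 0 + (\<Sum>a\<in>UNIV - {0}. h a)" for h :: "'p mod_ring \<Rightarrow> 'k"
    by (simp add: sum.remove)
  have 1: "\<theta> = 1 + 2 * sum e ?S"
    unfolding gauss_sum_eq by (subst split) (simp add: sum_squares_finite_field)
  have "(\<Sum>a\<in>UNIV. e (b * a\<^sup>2)) = 1 + 2 * (\<Sum>s\<in>?S. e (b * s))"
    by (subst split) (simp add: sum_squares_finite_field[where h="\<lambda>s. e (b * s)"])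
  also have "(\<Sum>s\<in>?S. e (b * s)) = sum e ((*) b ` ?S)"
    by (subst sum.reindex) (use assms in \<open>auto simp: inj_on_def\<close>)
  finally have "\<theta> + (\<Sum>a\<in>UNIV. e (b * a\<^sup>2)) = 2 * (1 + (sum e ?S + sum e ((*) b ` ?S)))"
    using 1 by (simp add: algebra_simps)
  also have "sum e ?S + sum e ((*) b ` ?S) = sum e (UNIV - {0})"
    by (subst sum.union_disjoint[symmetric]) (simp_all add: disj cover)
  also have "1 + sum e (UNIV - {0}) = 0"
    using split[of e] sum_e by simp
  finally have "(\<Sum>a\<in>UNIV. e (b * a\<^sup>2)) = - \<theta>"
    by (simp add: eq_neg_iff_add_eq_0 add.commute)
  thus ?thesis using False by (simp add: quadratic_char_def)
qed

text \<open>The product of \<theta> with the sum of \<open>e (- (b\<^sup>2))\<close> is computed as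
  a double sum. Putting \<open>a = c + b\<close> makes the exponent linear in \<open>b\<close>, and
  since 2 is nonzero only \<open>c = 0\<close> survives.\<close>

lemma gauss_sum_square: "\<theta>\<^sup>2 = of_int (quadratic_char (- 1 :: 'p mod_ring)) * of_nat CARD('p)"
proof -
  let ?\<chi> = "of_int (quadratic_char (- 1 :: 'p mod_ring)) :: 'k"
  have "?\<chi> * \<theta> = (\<Sum>b\<in>UNIV. e (- (b\<^sup>2)))"
    using gauss_sum_scaled[of "- 1"] by simp
  hence "\<theta> * (?\<chi> * \<theta>) = (\<Sum>a\<in>UNIV. \<Sum>b\<in>UNIV. e (a\<^sup>2) * e (- (b\<^sup>2)))"
    by (simp only: gauss_sum_eq sum_product)
  also have "\<dots> = (\<Sum>b\<in>UNIV. \<Sum>a\<in>UNIV. e (a\<^sup>2 - b\<^sup>2))"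
    by (subst sum.swap) (simp add: e_add[symmetric])
  also have "\<dots> = (\<Sum>b\<in>UNIV. \<Sum>c\<in>UNIV. e (c * c) * e (2 * c * b))"
  proof (rule sum.cong[OF refl])
    fix b :: "'p mod_ring"
    show "(\<Sum>a\<in>UNIV. e (a\<^sup>2 - b\<^sup>2)) = (\<Sum>c\<in>UNIV. e (c * c) * e (2 * c * b))"
      by (rule sum.reindex_bij_witness[of _ "\<lambda>c. c + b" "\<lambda>a. a - b"])
        (auto simp: e_add[symmetric] power2_eq_square algebra_simps)
  qed
  also have "\<dots> = (\<Sum>c\<in>UNIV. e (c * c) * (\<Sum>b\<in>UNIV. e (2 * c * b)))"
    by (subst sum.swap) (simp add: sum_distrib_left)
  also have "\<dots> = (\<Sum>c\<in>(UNIV :: 'p mod_ring set). if c = 0 then of_nat CARD('p) else 0)"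
    by (rule sum.cong) (auto simp: sum_e_mult)
  also have "\<dots> = of_nat CARD('p)" by simp
  finally have "?\<chi> * \<theta>\<^sup>2 = of_nat CARD('p)" by (simp add: power2_eq_square algebra_simps)
  hence "?\<chi> * ?\<chi> * \<theta>\<^sup>2 = ?\<chi> * of_nat CARD('p)" by (simp only: mult.assoc)
  moreover have "?\<chi> * ?\<chi> = 1" by (simp only: of_int_mult[symmetric]) simp
  ultimately show ?thesis by simp
qed

lemma gauss_sum_nonzero [simp]: "\<theta> \<noteq> 0"
proof
  assume "\<theta> = 0"
  hence "of_int (quadratic_char (- 1 :: 'p mod_ring)) * of_nat CARD('p) = (0::'k)"
    using gauss_sum_square by simp
  thus False using of_nat_p_nonzero by (auto simp: quadratic_char_def split: if_splits)
qed

end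

section \<open>Gram matrices over finite fields\<close>

definition gram :: "('v \<Rightarrow> 'v \<Rightarrow> 'k) \<Rightarrow> 'v list \<Rightarrow> 'k mat" where
  "gram F bs = Matrix.mat (length bs) (length bs) (\<lambda>(i, j). F (bs ! i) (bs ! j))"

lemma gram_carrier [simp]: "gram F bs \<in> carrier_mat (length bs) (length bs)"
  by (simp add: gram_def)

lemma gram_cong:
  assumes "\<And>x y. x \<in> set bs \<Longrightarrow> y \<in> set bs \<Longrightarrow> F x y = G x y"
  shows "gram F bs = gram G bs"
  unfolding gram_def by (rule eq_matI) (simp_all add: assms)

text \<open>Laplace expansion along the row of \<open>v\<close>, which vanishes off the diagonal;
  the column of \<open>v\<close> may be arbitrary.\<close>

lemma det_gram_Cons:
  fixes F :: "'v \<Rightarrow> 'v \<Rightarrow> 'k::comm_ring_1"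
  assumes "\<And>x. x \<in> set bs \<Longrightarrow> F v x = 0"
  shows "det (gram F (v # bs)) = F v v * det (gram F bs)"
proof -
  let ?M = "gram F (v # bs)" and ?m = "length bs"
  have "det ?M = (\<Sum>j<Suc ?m. ?M $$ (0, j) * cofactor ?M 0 j)"
    by (rule laplace_expansion_row) (simp_all add: gram_def)
  also have "\<dots> = ?M $$ (0, 0) * cofactor ?M 0 0 + (\<Sum>j<?m. ?M $$ (0, Suc j) * cofactor ?M 0 (Suc j))"
    by (rule sum.lessThan_Suc_shift)
  also have "(\<Sum>j<?m. ?M $$ (0, Suc j) * cofactor ?M 0 (Suc j)) = 0"
    by (rule sum.neutral) (simp add: gram_def assms)
  also have "mat_delete ?M 0 0 = gram F bs"
    by (rule eq_matI) (simp_all add: mat_delete_def gram_def)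
  hence "cofactor ?M 0 0 = det (gram F bs)" by (simp add: cofactor_def)
  finally show ?thesis by (simp add: gram_def)
qed

text \<open>A rank one update along the first row: row \<open>0\<close> is multiplied by \<open>1 - c F(v,v)\<close>, and from the
  other rows a multiple of row \<open>0\<close> is subtracted.\<close>

lemma det_gram_rank_one_update:
  fixes F G :: "'v \<Rightarrow> 'v \<Rightarrow> 'k::idom"
  assumes "\<And>x y. x \<in> set (v # bs) \<Longrightarrow> y \<in> set (v # bs) \<Longrightarrow> G x y = F x y - c * F v x * F v y"
  shows "det (gram G (v # bs)) = (1 - c * F v v) * det (gram F (v # bs))"
proof -
  let ?m = "Suc (length bs)"
  let ?b = "\<lambda>i. (v # bs) ! i"
  define L where "L = Matrix.mat ?m ?m (\<lambda>(i, j).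
    (if i = j then 1 else 0) - (if j = 0 then c * F v (?b i) else 0))"
  have L: "L \<in> carrier_mat ?m ?m" by (simp add: L_def)
  have "gram G (v # bs) = L * gram F (v # bs)"
  proof (rule eq_matI)
    fix i j assume "i < dim_row (L * gram F (v # bs))" "j < dim_col (L * gram F (v # bs))"
    hence i: "i < ?m" and j: "j < ?m" by (auto simp: L_def gram_def)
    have "(L * gram F (v # bs)) $$ (i, j) =
        (\<Sum>k<?m. ((if i = k then 1 else 0) - (if k = 0 then c * F v (?b i) else 0)) * F (?b k) (?b j))"
      using i j by (simp add: L_def gram_def scalar_prod_def lessThan_atLeast0)
    also have "\<dots> = (\<Sum>k<?m. (if k = i then F (?b k) (?b j) else 0)
        - (if k = 0 then c * F v (?b i) * F (?b k) (?b j) else 0))"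
      by (rule sum.cong) (auto simp: left_diff_distrib)
    also have "\<dots> = F (?b i) (?b j) - c * F v (?b i) * F v (?b j)"
      using i by (simp add: sum_subtractf del: sum.lessThan_Suc)
    also have "\<dots> = G (?b i) (?b j)"
      using assms[of "?b i" "?b j"] i j nth_mem[of i "v # bs"] nth_mem[of j "v # bs"] by simp
    finally show "gram G (v # bs) $$ (i, j) = (L * gram F (v # bs)) $$ (i, j)"
      using i j by (simp add: gram_def)
  qed (auto simp: L_def gram_def)
  moreover have "gram F (v # bs) \<in> carrier_mat ?m ?m" by (simp add: gram_def)
  ultimately have "det (gram G (v # bs)) = det L * det (gram F (v # bs))"
    using L by (simp add: det_mult)
  moreover have "det L = 1 - c * F v v"
  proof -
    have "det L = prod_list (diag_mat L)"
      by (rule det_lower_triangular[OF _ L]) (simp add: L_def)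
    also have "\<dots> = (\<Prod>i = 0..<?m. L $$ (i, i))"
      using L by (simp add: prod_list_diag_prod)
    also have "\<dots> = L $$ (0, 0) * (\<Prod>i = 0..<length bs. L $$ (Suc i, Suc i))"
      by (simp add: prod.atLeast0_lessThan_Suc_shift del: prod.op_ivl_Suc)
    also have "(\<Prod>i = 0..<length bs. L $$ (Suc i, Suc i)) = 1"
      by (rule prod.neutral) (simp add: L_def)
    finally show ?thesis by (simp add: L_def)
  qed
  ultimately show ?thesis by simp
qed

section \<open>Ordered bases and coordinates in a finite vector space\<close>

locale finite_space = vector_space scale
  for scale :: "'k::{field,finite} \<Rightarrow> 'v::ab_group_add \<Rightarrow> 'v" (infixr "*s" 75) +
  assumes finite_UNIV: "finite (UNIV :: 'v set)"
begin

lemma finite_sets [simp]: "finite (U :: 'v set)"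
  using finite_UNIV by (rule rev_finite_subset) simp

definition lincomb :: "'v list \<Rightarrow> (nat \<Rightarrow> 'k) \<Rightarrow> 'v" where
  "lincomb bs c = (\<Sum>i<length bs. c i *s bs ! i)"

text \<open>The prescribed initial list serves to put the centre of a transvection first; the empty
  list gives plain existence.\<close>

lemma ordered_basis_exists:
  assumes "subspace U" and "set as \<subseteq> U" and "distinct as" and "independent (set as)"
  obtains cs where "ordered_basis scale U (as @ cs)"
proof -
  obtain B where B: "set as \<subseteq> B" "B \<subseteq> U" "independent B" "U \<subseteq> span B"
    using maximal_independent_subset_extend assms by metis
  obtain cs where cs: "set cs = B - set as" "distinct cs"
    using finite_distinct_list[of "B - set as"] by auto
  have "set (as @ cs) = B" using B cs by auto
  moreover have "span B = U"
    using B assms(1) by (simp add: span_subspace)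
  ultimately have "ordered_basis scale U (as @ cs)"
    using assms(3) B cs unfolding ordered_basis_def by auto
  thus ?thesis by (rule that)
qed

context
  fixes U bs
  assumes bs: "ordered_basis scale U bs"
begin

lemma ordered_basis_length: "length bs = dim U"
  using bs unfolding ordered_basis_def
  by (metis dim_eq_card_independent dim_span distinct_card)

lemma ordered_basis_mem: "set bs \<subseteq> U"
  using bs unfolding ordered_basis_def by (metis span_superset)

lemma ordered_basis_nth_mem: "i < length bs \<Longrightarrow> bs ! i \<in> U"
  using ordered_basis_mem by auto

lemma ordered_basis_subspace: "subspace U"
  using bs unfolding ordered_basis_def by auto

lemma lincomb_mem: "lincomb bs c \<in> U"
  unfolding lincomb_def
  by (intro subspace_sum[OF ordered_basis_subspace] subspace_scale[OF ordered_basis_subspace])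
    (auto intro: ordered_basis_nth_mem)

lemma sum_set_eq_sum_nth:
  "(\<Sum>x\<in>set bs. (h x :: 'v)) = (\<Sum>i<length bs. h (bs ! i))"
proof -
  have "distinct bs" using bs by (simp add: ordered_basis_def)
  thus ?thesis
    by (intro sum.reindex_bij_betw[symmetric] bij_betw_nth) auto
qed

lemma lincomb_surj:
  assumes "x \<in> U"
  obtains c where "x = lincomb bs c"
proof -
  have "x \<in> span (set bs)" using assms bs by (simp add: ordered_basis_def)
  then obtain u where "x = (\<Sum>b\<in>set bs. u b *s b)"
    by (auto simp: span_finite)
  hence "x = lincomb bs (\<lambda>i. u (bs ! i))"
    by (simp add: lincomb_def sum_set_eq_sum_nth)
  thus ?thesis by (rule that)
qed

lemma lincomb_eq_0:
  assumes "lincomb bs c = 0" and i: "i < length bs"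
  shows "c i = 0"
proof -
  have dist: "distinct bs" and ind: "independent (set bs)"
    using bs by (auto simp: ordered_basis_def)
  \<comment> \<open>Moves the coefficients from positions to vectors, unambiguously because
    \<open>bs\<close> is distinct.\<close>
  define u where "u b = c (THE i. i < length bs \<and> bs ! i = b)" for b
  have u: "u (bs ! j) = c j" if "j < length bs" for j
  proof -
    have "(THE i. i < length bs \<and> bs ! i = bs ! j) = j"
      by (rule the_equality) (use that dist nth_eq_iff_index_eq in auto)
    thus ?thesis by (simp add: u_def)
  qed
  have "(\<Sum>b\<in>set bs. u b *s b) = lincomb bs c"
    by (simp add: lincomb_def sum_set_eq_sum_nth u)
  hence "u (bs ! i) = 0"
    using independentD[OF ind, of "set bs" u "bs ! i"] assms by simp
  thus ?thesis using u i by simp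
qed

lemma lincomb_diff: "lincomb bs c - lincomb bs d = lincomb bs (\<lambda>i. c i - d i)"
  by (simp add: lincomb_def sum_subtractf scale_left_diff_distrib)

lemma lincomb_inj:
  assumes "lincomb bs c = lincomb bs d" and "i < length bs"
  shows "c i = d i"
  using lincomb_eq_0[of "\<lambda>i. c i - d i" i] assms lincomb_diff[of c d] by simp

lemma card_ordered_basis: "card U = CARD('k) ^ length bs"
proof -
  have "bij_betw (lincomb bs) ({..<length bs} \<rightarrow>\<^sub>E UNIV) U"
    unfolding bij_betw_def
  proof (intro conjI inj_onI equalityI subsetI)
    fix c d
    assume cd: "c \<in> {..<length bs} \<rightarrow>\<^sub>E UNIV" "d \<in> {..<length bs} \<rightarrow>\<^sub>E UNIV" "lincomb bs c = lincomb bs d"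
    show "c = d" by (rule PiE_ext[OF cd(1,2)]) (use lincomb_inj cd in auto)
  next
    fix x assume "x \<in> U"
    then obtain c where "x = lincomb bs c" by (rule lincomb_surj)
    also have "\<dots> = lincomb bs (restrict c {..<length bs})" by (simp add: lincomb_def)
    finally show "x \<in> lincomb bs ` ({..<length bs} \<rightarrow>\<^sub>E UNIV)" by auto
  qed (auto intro: lincomb_mem)
  hence "card U = card ({..<length bs} \<rightarrow>\<^sub>E (UNIV :: 'k set))" by (simp add: bij_betw_same_card)
  thus ?thesis by (simp add: card_PiE)
qed

end

lemma card_subspace: "subspace U \<Longrightarrow> card U = CARD('k) ^ dim U"
  by (metis append_Nil card_ordered_basis distinct.simps(1) empty_set empty_subsetI
      independent_empty ordered_basis_exists ordered_basis_length)

section \<open>Bilinear forms on a subspace and their Gram determinants\<close>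

definition bilinear_on :: "'v set \<Rightarrow> ('v \<Rightarrow> 'v \<Rightarrow> 'k) \<Rightarrow> bool" where
  "bilinear_on U F \<longleftrightarrow> subspace U \<and>
     (\<forall>x\<in>U. \<forall>y\<in>U. \<forall>z\<in>U. F (x + y) z = F x z + F y z \<and> F z (x + y) = F z x + F z y) \<and>
     (\<forall>c. \<forall>x\<in>U. \<forall>y\<in>U. F (c *s x) y = c * F x y \<and> F x (c *s y) = c * F x y)"

lemma bilinear_on_lincomb:
  assumes F: "bilinear_on U F" and mem: "\<And>i. i < length bs \<Longrightarrow> bs ! i \<in> U" and y: "y \<in> U"
  shows "F (lincomb bs c) y = (\<Sum>i<length bs. c i * F (bs ! i) y)"
    and "F y (lincomb bs c) = (\<Sum>i<length bs. c i * F y (bs ! i))"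
proof -
  have U: "subspace U" using F by (simp add: bilinear_on_def)
  \<comment> \<open>Linearity is available only inside \<open>U\<close>, so the induction carries
    the membership of the partial sums.\<close>
  have *: "(\<Sum>i<m. c i *s bs ! i) \<in> U \<and>
      F (\<Sum>i<m. c i *s bs ! i) y = (\<Sum>i<m. c i * F (bs ! i) y) \<and>
      F y (\<Sum>i<m. c i *s bs ! i) = (\<Sum>i<m. c i * F y (bs ! i))" if "m \<le> length bs" for m
    using that
  proof (induction m)
    case 0
    have "F 0 y = 0 * F 0 y \<and> F y 0 = 0 * F y 0"
      using F y subspace_0[OF U] unfolding bilinear_on_def by (metis scale_zero_left)
    thus ?case using subspace_0[OF U] by simp
  next
    case (Suc m)
    have "bs ! m \<in> U" using Suc.prems mem by simp
    moreover from this have "c m *s bs ! m \<in> U" by (rule subspace_scale[OF U])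
    ultimately show ?case
      using Suc F y subspace_add[OF U] unfolding bilinear_on_def by (simp add: Suc_le_eq)
  qed
  show "F (lincomb bs c) y = (\<Sum>i<length bs. c i * F (bs ! i) y)"
    and "F y (lincomb bs c) = (\<Sum>i<length bs. c i * F y (bs ! i))"
    using *[of "length bs"] by (simp_all add: lincomb_def)
qed

text \<open>If \<open>M\<close> holds the coordinates of the new basis in the old one, the Gram
  matrix is multiplied by \<open>M\<close> on the left and by its transpose on the right; so
  \<open>r = det M\<close>.\<close>

lemma det_gram_basis_change:
  assumes bs: "ordered_basis scale U bs" and cs: "ordered_basis scale U cs" and F: "bilinear_on U F"
  obtains r where "det (gram F cs) = r\<^sup>2 * det (gram F bs)"
proof -
  let ?m = "length bs"
  have len: "length cs = ?m"
    using ordered_basis_length[OF bs] ordered_basis_length[OF cs] by simp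
  have "\<forall>i. \<exists>c. i < ?m \<longrightarrow> cs ! i = lincomb bs c"
    using lincomb_surj[OF bs] ordered_basis_nth_mem[OF cs] len by metis
  then obtain P where P: "\<And>i. i < ?m \<Longrightarrow> cs ! i = lincomb bs (P i)" by metis
  define M where "M = Matrix.mat ?m ?m (\<lambda>(i, j). P i j)"
  have M: "M \<in> carrier_mat ?m ?m" by (simp add: M_def)
  have "gram F cs = M * gram F bs * transpose_mat M"
  proof (rule eq_matI)
    fix i j assume ij: "i < dim_row (M * gram F bs * transpose_mat M)"
      "j < dim_col (M * gram F bs * transpose_mat M)"
    hence i: "i < ?m" and j: "j < ?m" by (auto simp: M_def)
    have "F (cs ! i) (cs ! j) = (\<Sum>k<?m. P i k * (\<Sum>l<?m. P j l * F (bs ! k) (bs ! l)))"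
      unfolding P[OF i] P[OF j]
      by (subst bilinear_on_lincomb(1)[OF F ordered_basis_nth_mem[OF bs] lincomb_mem[OF bs]], assumption)
        (auto intro!: sum.cong simp: bilinear_on_lincomb(2)[OF F ordered_basis_nth_mem[OF bs]]
          ordered_basis_nth_mem[OF bs])
    also have "\<dots> = (\<Sum>l<?m. (\<Sum>k<?m. P i k * F (bs ! k) (bs ! l)) * P j l)"
      by (simp add: sum_distrib_left sum_distrib_right mult_ac) (rule sum.swap)
    finally show "gram F cs $$ (i, j) = (M * gram F bs * transpose_mat M) $$ (i, j)"
      using i j len by (simp add: M_def gram_def scalar_prod_def lessThan_atLeast0)
  qed (auto simp: M_def gram_def len)
  hence "det (gram F cs) = det M * det (gram F bs) * det M"
    using M by (simp add: det_mult[of _ ?m] det_transpose[OF M])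
  thus ?thesis using that[of "det M"] by (simp add: power2_eq_square mult_ac)
qed

text \<open>The functional is found by counting: \<open>y \<mapsto> F(_, y)\<close> is injective by nondegeneracy, and
  there are no more functionals on \<open>U\<close> than elements of \<open>U\<close>.\<close>

lemma functional_represented:
  assumes F: "bilinear_on U F" and nondeg: "\<And>y. y \<in> U \<Longrightarrow> (\<forall>x\<in>U. F x y = 0) \<Longrightarrow> y = 0"
    and add: "\<And>x y. x \<in> U \<Longrightarrow> y \<in> U \<Longrightarrow> \<phi> (x + y) = \<phi> x + \<phi> y"
    and hom: "\<And>c x. x \<in> U \<Longrightarrow> \<phi> (c *s x) = c * \<phi> x"
  obtains y where "y \<in> U" "\<And>x. x \<in> U \<Longrightarrow> \<phi> x = F x y"
proof -
  have U: "subspace U" using F by (simp add: bilinear_on_def)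
  obtain bs where bs: "ordered_basis scale U bs"
    using ordered_basis_exists[OF U, of "[]"] independent_empty by auto
  let ?m = "length bs"
  define E where "E y = restrict (\<lambda>i. F (bs ! i) y) {..<?m}" for y
  have "inj_on E U"
  proof (rule inj_onI)
    fix y z assume yz: "y \<in> U" "z \<in> U" "E y = E z"
    have mem: "y - z \<in> U" using yz by (intro subspace_diff[OF U])
    have "F (bs ! i) (y - z) = 0" if i: "i < ?m" for i
    proof -
      have "F (bs ! i) y = F (bs ! i) (y - z) + F (bs ! i) z"
        using F mem yz(2) ordered_basis_nth_mem[OF bs i] unfolding bilinear_on_def
        by (metis diff_add_cancel)
      moreover have "F (bs ! i) y = F (bs ! i) z"
        using fun_cong[OF yz(3), of i] i by (simp add: E_def)
      ultimately show ?thesis by simp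
    qed
    hence "F x (y - z) = 0" if "x \<in> U" for x
      using lincomb_surj[OF bs that] bilinear_on_lincomb(1)[OF F ordered_basis_nth_mem[OF bs] mem]
      by (metis (no_types, lifting) lessThan_iff mult_zero_right sum.neutral)
    hence "y - z = 0" using nondeg[OF mem] by blast
    thus "y = z" by simp
  qed
  moreover have "E ` U \<subseteq> {..<?m} \<rightarrow>\<^sub>E UNIV" by (auto simp: E_def split: if_splits)
  moreover have "card U = card ({..<?m} \<rightarrow>\<^sub>E (UNIV :: 'k set))"
    by (simp add: card_PiE card_ordered_basis[OF bs])
  ultimately have surj: "E ` U = {..<?m} \<rightarrow>\<^sub>E UNIV"
    by (intro card_subset_eq) (simp_all add: finite_PiE card_image)
  have "restrict (\<lambda>i. \<phi> (bs ! i)) {..<?m} \<in> E ` U" unfolding surj by auto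
  then obtain y where y: "y \<in> U" "E y = restrict (\<lambda>i. \<phi> (bs ! i)) {..<?m}" by auto
  have \<phi>_lincomb: "(\<Sum>i<m. c i *s bs ! i) \<in> U \<and> \<phi> (\<Sum>i<m. c i *s bs ! i) = (\<Sum>i<m. c i * \<phi> (bs ! i))"
    if "m \<le> ?m" for m c
    using that
  proof (induction m)
    case 0
    thus ?case using hom[OF subspace_0[OF U], of 0] subspace_0[OF U] by simp
  next
    case (Suc m)
    have "bs ! m \<in> U" using Suc.prems ordered_basis_nth_mem[OF bs] by simp
    thus ?case
      using Suc add hom subspace_add[OF U] subspace_scale[OF U] by (simp add: Suc_le_eq)
  qed
  have "\<phi> x = F x y" if x: "x \<in> U" for x
  proof -
    obtain c where c: "x = lincomb bs c" by (rule lincomb_surj[OF bs x])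
    have "\<phi> (bs ! i) = F (bs ! i) y" if "i < ?m" for i
      using fun_cong[OF y(2), of i] that by (simp add: E_def)
    moreover have "F (lincomb bs c) y = (\<Sum>i<?m. c i * F (bs ! i) y)"
      by (rule bilinear_on_lincomb(1)[OF F _ y(1)]) (rule ordered_basis_nth_mem[OF bs])
    ultimately show ?thesis
      using \<phi>_lincomb[of ?m c] by (simp add: c lincomb_def)
  qed
  thus ?thesis using that y(1) by blast
qed

text \<open>A null vector of the Gram matrix, read as coordinates, is a \<open>y\<close> with
  \<open>F x y = 0\<close> for all \<open>x\<close> in \<open>U\<close>.\<close>

lemma det_gram_nonzero:
  assumes bs: "ordered_basis scale U bs" and F: "bilinear_on U F"
    and nondeg: "\<And>y. y \<in> U \<Longrightarrow> (\<forall>x\<in>U. F x y = 0) \<Longrightarrow> y = 0"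
  shows "det (gram F bs) \<noteq> 0"
proof
  let ?m = "length bs"
  assume "det (gram F bs) = 0"
  then obtain v where v: "v \<in> carrier_vec ?m" "v \<noteq> 0\<^sub>v ?m" "gram F bs *\<^sub>v v = 0\<^sub>v ?m"
    using det_0_iff_vec_prod_zero[OF gram_carrier] by blast
  define y where "y = lincomb bs (\<lambda>j. v $ j)"
  have yU: "y \<in> U" unfolding y_def by (rule lincomb_mem[OF bs])
  have row: "F (bs ! i) y = 0" if i: "i < ?m" for i
  proof -
    have "F (bs ! i) y = (gram F bs *\<^sub>v v) $ i"
      unfolding y_def
      using bilinear_on_lincomb(2)[OF F ordered_basis_nth_mem[OF bs] ordered_basis_nth_mem[OF bs i]]
        i v(1)
      by (simp add: gram_def scalar_prod_def lessThan_atLeast0 mult.commute)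
    thus ?thesis using v(3) i by simp
  qed
  have "F x y = 0" if x: "x \<in> U" for x
  proof -
    obtain c where c: "x = lincomb bs c" by (rule lincomb_surj[OF bs x])
    have "F (lincomb bs c) y = (\<Sum>i<?m. c i * F (bs ! i) y)"
      by (rule bilinear_on_lincomb(1)[OF F _ yU]) (rule ordered_basis_nth_mem[OF bs])
    thus ?thesis using row by (simp add: c)
  qed
  hence "y = 0" using nondeg[OF yU] by blast
  hence "v $ i = 0" if "i < ?m" for i
    using lincomb_eq_0[OF bs] that by (simp add: y_def)
  hence "v = 0\<^sub>v ?m" using v(1) by auto
  thus False using v(2) by contradiction
qed

end

section \<open>The Wall form of a product with a transvection\<close>

locale symplectic = finite_space scale
  for scale :: "'k::{field,finite} \<Rightarrow> 'v::ab_group_add \<Rightarrow> 'v" (infixr "*s" 75) +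
  fixes f :: "'v \<Rightarrow> 'v \<Rightarrow> 'k"
  assumes form: "symplectic_form scale f" and two_neq_0: "(2::'k) \<noteq> 0"
begin

lemma f_add_left: "f (x + y) z = f x z + f y z"
  and f_scale_left: "f (c *s x) z = c * f x z"
  and f_add_right: "f z (x + y) = f z x + f z y"
  and f_scale_right: "f z (c *s x) = c * f z x"
  using form unfolding symplectic_form_def Vector_Spaces.linear_iff by auto

lemma f_self [simp]: "f x x = 0"
  using form by (simp add: symplectic_form_def)

lemma f_zero [simp]: "f 0 x = 0" "f x 0 = 0"
  using f_scale_left[of 0 x x] f_scale_right[of x 0 x] by simp_all

lemma f_minus_left: "f (- x) z = - f x z"
  and f_minus_right: "f z (- x) = - f z x"
  using f_scale_left[of "- 1" x z] f_scale_right[of z "- 1" x] by simp_all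

lemma f_diff_left: "f (x - y) z = f x z - f y z"
  and f_diff_right: "f z (x - y) = f z x - f z y"
  using f_add_left[of x "- y" z] f_add_right[of z x "- y"]
  by (simp_all add: f_minus_left f_minus_right)

lemmas f_linear = f_add_left f_add_right f_diff_left f_diff_right f_scale_left f_scale_right

lemma f_swap: "f y x = - f x y"
proof -
  have "0 = f (x + y) (x + y)" by simp
  also have "\<dots> = f x y + f y x" unfolding f_add_left f_add_right by simp
  finally show ?thesis by (metis add.commute eq_neg_iff_add_eq_0)
qed

lemma f_nondegenerate: "(\<And>u. f u x = 0) \<Longrightarrow> x = 0"
  using form f_swap unfolding symplectic_form_def by (metis neg_0_equal_iff_equal)

section \<open>Isometries and the form on \<open>I_space g\<close>\<close>

definition isometry :: "('v \<Rightarrow> 'v) \<Rightarrow> bool" where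
  "isometry g \<longleftrightarrow> Vector_Spaces.linear scale scale g \<and> bij g \<and> (\<forall>x y. f (g x) (g y) = f x y)"

lemma carrier_Sp: "carrier (Sp scale f) = {g. isometry g}"
  by (auto simp: Sp_def GL_def isometry_def)

lemma isometry_f: "isometry g \<Longrightarrow> f (g x) (g y) = f x y"
  by (simp add: isometry_def)

lemma isometry_linear:
  assumes "isometry g"
  shows isometry_add: "g (x + y) = g x + g y"
    and isometry_scale: "g (c *s x) = c *s g x"
    and isometry_diff: "g (x - y) = g x - g y"
proof -
  show add: "g (x + y) = g x + g y" for x y
    using assms unfolding isometry_def Vector_Spaces.linear_iff by blast
  show "g (c *s x) = c *s g x"
    using assms unfolding isometry_def Vector_Spaces.linear_iff by blast
  show "g (x - y) = g x - g y"
    using add[of "x - y" y] by simp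
qed

lemma isometry_id: "isometry id"
  using linear_id by (simp add: isometry_def id_def bij_id[unfolded id_def])

lemma isometry_comp:
  assumes "isometry g" "isometry h"
  shows "isometry (h \<circ> g)"
  using assms unfolding isometry_def
  by (auto intro: Vector_Spaces.linear_compose bij_comp)

lemma I_space_mem [simp]: "u - g u \<in> I_space g"
  by (simp add: I_space_def)

lemma I_spaceE:
  assumes "x \<in> I_space g"
  obtains u where "x = u - g u"
  using assms by (auto simp: I_space_def)

lemma subspace_I_space:
  assumes "isometry g"
  shows "subspace (I_space g)"
proof (rule subspaceI)
  show "0 \<in> I_space g"
    using I_space_mem[of 0 g] isometry_scale[OF assms, of 0 0] by simp
next
  fix x y assume "x \<in> I_space g" "y \<in> I_space g"
  then obtain u w where uw: "x = u - g u" "y = w - g w" by (metis I_spaceE)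
  hence "x + y = (u + w) - g (u + w)"
    using isometry_add[OF assms, of u w] by (simp add: algebra_simps)
  thus "x + y \<in> I_space g" by simp
next
  fix c x assume "x \<in> I_space g"
  then obtain u where "x = u - g u" by (rule I_spaceE)
  thus "c *s x \<in> I_space g"
    using I_space_mem[of "c *s u" g] isometry_scale[OF assms] by (simp add: scale_right_diff_distrib)
qed

text \<open>Two preimages under 1 - g differ by a fixed vector \<open>k\<close>, and
  \<open>f k (g w) = f (g k) (g w) = f k w\<close> shows that fixed vectors are orthogonal to
  \<open>I_space g\<close>. Hence the choice inside \<open>I_form\<close> is immaterial.\<close>

lemma I_form_eq:
  assumes g: "isometry g" and y: "y \<in> I_space g"
  shows "I_form f g (u - g u) y = f u y"
proof -
  define u' where "u' = (SOME u'. u - g u = u' - g u')"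
  have u': "u - g u = u' - g u'"
    unfolding u'_def by (rule someI) (rule refl)
  obtain w where w: "y = w - g w" using y by (rule I_spaceE)
  have fixed: "g (u - u') = u - u'"
    unfolding isometry_diff[OF g] using u' by (simp add: algebra_simps)
  have "f (u - u') (g w) = f (u - u') w"
    using isometry_f[OF g, of "u - u'" w] fixed by simp
  hence "f u y = f u' y"
    by (simp add: w f_diff_left f_diff_right algebra_simps)
  thus ?thesis unfolding I_form_def u'_def by simp
qed

lemma bilinear_on_I_form:
  assumes g: "isometry g"
  shows "bilinear_on (I_space g) (I_form f g)"
  unfolding bilinear_on_def
proof (intro conjI ballI allI)
  show "subspace (I_space g)" by (rule subspace_I_space[OF g])
next
  fix x y z assume xyz: "x \<in> I_space g" "y \<in> I_space g" "z \<in> I_space g"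
  obtain u v w where uvw: "x = u - g u" "y = v - g v" "z = w - g w"
    using xyz by (metis I_spaceE)
  have xy: "x + y = (u + v) - g (u + v)"
    using uvw isometry_add[OF g, of u v] by (simp add: algebra_simps)
  show "I_form f g (x + y) z = I_form f g x z + I_form f g y z"
    unfolding xy I_form_eq[OF g xyz(3)]
    by (simp add: uvw(1,2) I_form_eq[OF g xyz(3)] f_add_left)
  show "I_form f g z (x + y) = I_form f g z x + I_form f g z y"
    using subspace_add[OF subspace_I_space[OF g] xyz(1,2)] xyz
    by (simp add: uvw(3) I_form_eq[OF g] f_add_right)
next
  fix c x y assume xy: "x \<in> I_space g" "y \<in> I_space g"
  obtain u v where uv: "x = u - g u" "y = v - g v" using xy by (metis I_spaceE)
  have cx: "c *s x = (c *s u) - g (c *s u)"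
    using uv isometry_scale[OF g] by (simp add: scale_right_diff_distrib)
  show "I_form f g (c *s x) y = c * I_form f g x y"
    unfolding cx I_form_eq[OF g xy(2)]
    by (simp add: uv(1) I_form_eq[OF g xy(2)] f_scale_left)
  show "I_form f g x (c *s y) = c * I_form f g x y"
    using subspace_scale[OF subspace_I_space[OF g] xy(2), of c] xy(2)
    by (simp add: uv(1) I_form_eq[OF g] f_scale_right)
qed

lemma
  assumes "isometry g" "x \<in> I_space g" "y \<in> I_space g" "z \<in> I_space g"
  shows I_form_add_left: "I_form f g (x + y) z = I_form f g x z + I_form f g y z"
    and I_form_add_right: "I_form f g z (x + y) = I_form f g z x + I_form f g z y"
    and I_form_scale_left: "I_form f g (c *s x) y = c * I_form f g x y"
    and I_form_scale_right: "I_form f g x (c *s y) = c * I_form f g x y"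
  using bilinear_on_I_form[OF assms(1)] assms unfolding bilinear_on_def by blast+

text \<open>This replaces symmetry, which the Wall form lacks in general: its skew part is governed
  by \<open>f\<close>. The two expansions agree because
  \<open>f (g u) (g v) = f u v\<close>.\<close>

lemma I_form_commutator:
  assumes g: "isometry g" and "x \<in> I_space g" "y \<in> I_space g"
  shows "I_form f g x y - I_form f g y x = f x y"
proof -
  obtain u v where uv: "x = u - g u" "y = v - g v" using assms by (metis I_spaceE)
  have "I_form f g x y = f u y" "I_form f g y x = f v x"
    using assms uv by (simp_all add: I_form_eq[OF g])
  thus ?thesis
    by (simp add: uv f_linear isometry_f[OF g] f_swap[of v u] f_swap[of v "g u"])
qed

lemma I_form_nondegenerate:
  assumes g: "isometry g" and y: "y \<in> I_space g" and "\<forall>x\<in>I_space g. I_form f g x y = 0"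
  shows "y = 0"
  by (rule f_nondegenerate) (use assms I_form_eq[OF g y] I_space_mem in metis)

text \<open>Frees \<open>I_disc\<close> from the chosen basis: a change of basis multiplies the
  determinant by \<open>r\<^sup>2\<close>, and nondegeneracy makes \<open>r\<close> nonzero.\<close>

lemma I_disc_eq:
  assumes g: "isometry g" and bs: "ordered_basis scale (I_space g) bs"
  shows "I_disc scale f g = quadratic_char (det (gram (I_form f g) bs))"
proof -
  define cs where "cs = (SOME cs. ordered_basis scale (I_space g) cs)"
  have cs: "ordered_basis scale (I_space g) cs"
    unfolding cs_def by (rule someI) (rule bs)
  obtain r where r: "det (gram (I_form f g) cs) = r\<^sup>2 * det (gram (I_form f g) bs)"
    by (rule det_gram_basis_change[OF bs cs bilinear_on_I_form[OF g]])
  have "det (gram (I_form f g) cs) \<noteq> 0"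
    by (rule det_gram_nonzero[OF cs bilinear_on_I_form[OF g] I_form_nondegenerate[OF g]])
  hence "r \<noteq> 0" using r by auto
  hence "quadratic_char (det (gram (I_form f g) cs)) = quadratic_char (det (gram (I_form f g) bs))"
    unfolding r by (rule quadratic_char_square_mult)
  thus ?thesis by (simp add: I_disc_def gram_def cs_def Let_def)
qed

lemma I_form_basis_exists:
  assumes g: "isometry g"
  obtains bs where "ordered_basis scale (I_space g) bs" "det (gram (I_form f g) bs) \<noteq> 0"
proof -
  obtain bs where bs: "ordered_basis scale (I_space g) bs"
    using ordered_basis_exists[OF subspace_I_space[OF g], of "[]"] independent_empty by auto
  have "det (gram (I_form f g) bs) \<noteq> 0"
    by (rule det_gram_nonzero[OF bs bilinear_on_I_form[OF g] I_form_nondegenerate[OF g]])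
  thus ?thesis using bs that by blast
qed

text \<open>Dividing by \<open>b\<close>, instead of multiplying, makes the Wall form of the
  transvection take the value \<open>b\<close> at \<open>(v, v)\<close> when \<open>b\<close> and
  \<open>v\<close> are nonzero. The inverse has parameter \<open>- b\<close>.\<close>

definition transvection :: "'v \<Rightarrow> 'k \<Rightarrow> 'v \<Rightarrow> 'v" where
  "transvection v b u = u - (f u v / b) *s v"

lemma transvection_inverse: "b \<noteq> 0 \<Longrightarrow> transvection v (- b) (transvection v b u) = u"
  by (simp add: transvection_def f_diff_left f_scale_left)

lemma isometry_transvection:
  assumes "b \<noteq> 0"
  shows "isometry (transvection v b)"
  unfolding isometry_def
proof (intro conjI allI)
  show "Vector_Spaces.linear scale scale (transvection v b)"
    using vector_space_axioms
    by (simp add: Vector_Spaces.linear_iff transvection_def f_add_left f_scale_left add_divide_distrib algebra_simps)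
  have "- b \<noteq> 0" using assms by simp
  show "bij (transvection v b)"
    by (rule o_bij[where g = "transvection v (- b)"])
      (use transvection_inverse[OF assms] transvection_inverse[OF \<open>- b \<noteq> 0\<close>] in \<open>auto simp: fun_eq_iff\<close>)
  show "f (transvection v b x) (transvection v b y) = f x y" for x y
    by (simp add: transvection_def f_linear f_swap[of v y])
qed

lemma transvection_comp_diff:
  "u - (transvection v b \<circ> g) u = (u - g u) + (f (g u) v / b) *s v"
  by (simp add: transvection_def)

lemma isometry_transvection_comp:
  "isometry g \<Longrightarrow> b \<noteq> 0 \<Longrightarrow> isometry (transvection v b \<circ> g)"
  by (intro isometry_comp isometry_transvection)

context
  fixes g :: "'v \<Rightarrow> 'v" and v :: 'v and b :: 'k
  assumes g: "isometry g" and b: "b \<noteq> 0"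
begin

section \<open>Product with a transvection whose centre lies outside the image of 1 - g\<close>

context
  assumes v: "v \<notin> I_space g"
begin

text \<open>If all fixed vectors were orthogonal to \<open>v\<close>, then
  \<open>u - g u \<mapsto> f u v\<close> would be a well defined functional on
  \<open>I_space g\<close>. The Wall form represents it by some \<open>y\<close> in
  \<open>I_space g\<close>; then \<open>f u v = f u y\<close> for all \<open>u\<close>, so
  \<open>v = y\<close>.\<close>

lemma fixed_vector_exists: "\<exists>k. g k = k \<and> f k v \<noteq> 0"
proof (rule ccontr)
  assume "\<nexists>k. g k = k \<and> f k v \<noteq> 0"
  hence ker: "g k = k \<Longrightarrow> f k v = 0" for k by blast
  define \<phi> where "\<phi> x = f (SOME u. x = u - g u) v" for x
  have \<phi>: "\<phi> (u - g u) = f u v" for u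
  proof -
    define u' where "u' = (SOME u'. u - g u = u' - g u')"
    have "u - g u = u' - g u'" unfolding u'_def by (rule someI) (rule refl)
    hence "g (u - u') = u - u'"
      unfolding isometry_diff[OF g] by (simp add: algebra_simps)
    hence "f u v = f u' v" using ker[of "u - u'"] by (simp add: f_diff_left)
    thus ?thesis by (simp add: \<phi>_def u'_def)
  qed
  obtain y where y: "y \<in> I_space g" "\<And>x. x \<in> I_space g \<Longrightarrow> \<phi> x = I_form f g x y"
  proof (rule functional_represented[OF bilinear_on_I_form[OF g] I_form_nondegenerate[OF g]])
    fix x y assume "x \<in> I_space g" "y \<in> I_space g"
    then obtain u w where uw: "x = u - g u" "y = w - g w" by (metis I_spaceE)
    have "x + y = (u + w) - g (u + w)" using uw isometry_add[OF g, of u w] by (simp add: algebra_simps)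
    hence "\<phi> (x + y) = f (u + w) v" by (simp only: \<phi>)
    thus "\<phi> (x + y) = \<phi> x + \<phi> y" by (simp add: uw \<phi> f_add_left)
  next
    fix c x assume "x \<in> I_space g"
    then obtain u where u: "x = u - g u" by (rule I_spaceE)
    have "c *s x = (c *s u) - g (c *s u)"
      using u isometry_scale[OF g] by (simp add: scale_right_diff_distrib)
    hence "\<phi> (c *s x) = f (c *s u) v" by (simp only: \<phi>)
    thus "\<phi> (c *s x) = c * \<phi> x" by (simp add: u \<phi> f_scale_left)
  qed auto
  have "f u (v - y) = 0" for u
    using y(2)[of "u - g u"] by (simp add: \<phi> I_form_eq[OF g y(1)] f_diff_right)
  hence "v - y = 0" by (rule f_nondegenerate)
  thus False using v y(1) by simp
qed

lemma transvection_preimage: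
  assumes "x \<in> I_space g"
  obtains u where "x = u - g u" "x + c *s v = u - (transvection v b \<circ> g) u" "f u v = f x v + b * c"
proof -
  obtain k where k: "g k = k" "f k v \<noteq> 0" using fixed_vector_exists by auto
  obtain u\<^sub>0 where u\<^sub>0: "x = u\<^sub>0 - g u\<^sub>0" using assms by (rule I_spaceE)
  \<comment> \<open>Adding a multiple of the fixed vector \<open>k\<close> preserves
    \<open>u - g u\<close> and shifts \<open>f (g u) v\<close> at will; the multiple is chosen to
    reach \<open>b * c\<close>, which gives \<open>v\<close> the coefficient
    \<open>c\<close>.\<close>
  define u where "u = u\<^sub>0 + ((b * c - f (g u\<^sub>0) v) / f k v) *s k"
  have x: "x = u - g u"
    by (simp add: u_def u\<^sub>0 isometry_linear[OF g] k(1))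
  have "f (g u) v = b * c"
    using k by (simp add: u_def isometry_linear[OF g] f_linear)
  moreover from this have "f u v = f x v + b * c" by (simp add: x f_diff_left)
  ultimately show ?thesis
    using that[OF x] b unfolding transvection_comp_diff by (simp add: x)
qed

lemma I_space_transvection_extend:
  "I_space (transvection v b \<circ> g) = {x + c *s v | x c. x \<in> I_space g}" (is "?L = ?R")
proof (intro equalityI subsetI)
  fix z assume "z \<in> ?L"
  then obtain u where "z = u - (transvection v b \<circ> g) u" by (rule I_spaceE)
  hence "z = (u - g u) + (f (g u) v / b) *s v" by (simp only: transvection_comp_diff)
  thus "z \<in> ?R" using I_space_mem by blast
next
  fix z assume "z \<in> ?R"
  then obtain x c where z: "z = x + c *s v" "x \<in> I_space g" by blast
  obtain u where "z = u - (transvection v b \<circ> g) u"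
    using transvection_preimage[OF z(2), of c] z(1) by metis
  thus "z \<in> ?L" by (metis I_space_mem)
qed

text \<open>For \<open>x = 0\<close> and \<open>d = 0\<close> the right side vanishes:
  \<open>v\<close> pairs to zero from the left with \<open>I_space g\<close>. With \<open>v\<close>
  put first, the Gram matrix is therefore block triangular.\<close>

lemma I_form_transvection_extend:
  assumes x: "x \<in> I_space g" and y: "y \<in> I_space g"
  shows "I_form f (transvection v b \<circ> g) (x + c *s v) (y + d *s v)
    = I_form f g x y + d * (f x v + b * c)"
proof -
  obtain u where u: "x = u - g u" "x + c *s v = u - (transvection v b \<circ> g) u" "f u v = f x v + b * c"
    using x by (rule transvection_preimage)
  have mem: "y + d *s v \<in> I_space (transvection v b \<circ> g)"
    using y by (auto simp: I_space_transvection_extend)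
  have "I_form f (transvection v b \<circ> g) (x + c *s v) (y + d *s v) = f u (y + d *s v)"
    unfolding u(2) by (rule I_form_eq[OF isometry_transvection_comp[OF g b] mem])
  also have "\<dots> = f u y + d * (f x v + b * c)"
    by (simp add: f_add_right f_scale_right u(3))
  also have "f u y = I_form f g x y"
    unfolding u(1) by (rule I_form_eq[OF g y, symmetric])
  finally show ?thesis .
qed

lemma
  shows dim_transvection_extend:
      "dim (I_space (transvection v b \<circ> g)) = Suc (dim (I_space g))"
    and I_disc_transvection_extend:
      "I_disc scale f (transvection v b \<circ> g) = quadratic_char b * I_disc scale f g"
proof -
  let ?h = "transvection v b \<circ> g"
  have h: "isometry ?h" by (rule isometry_transvection_comp[OF g b])
  obtain bs where bs: "ordered_basis scale (I_space g) bs" "det (gram (I_form f g) bs) \<noteq> 0"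
    using I_form_basis_exists[OF g] .
  note mem = ordered_basis_mem[OF bs(1)]
  have span: "span (set bs) = I_space g" and ind: "independent (set bs)" and dist: "distinct bs"
    using bs(1) by (auto simp: ordered_basis_def)
  have "span (set (v # bs)) = I_space ?h"
    unfolding I_space_transvection_extend
    by (auto simp: span_breakdown_eq span) (metis diff_add_cancel, metis add_diff_cancel_right')
  moreover have "independent (set (v # bs))"
    using ind v span by (simp add: independent_insertI)
  ultimately have vbs: "ordered_basis scale (I_space ?h) (v # bs)"
    using v dist mem by (auto simp: ordered_basis_def)
  show "dim (I_space ?h) = Suc (dim (I_space g))"
    using ordered_basis_length[OF vbs] ordered_basis_length[OF bs(1)] by simp
  have 0: "0 \<in> I_space g" by (rule subspace_0[OF subspace_I_space[OF g]])
  have v0: "I_form f ?h v x = 0" if "x \<in> set bs" for x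
  proof -
    have "I_form f ?h v x = I_form f g 0 x"
      using I_form_transvection_extend[OF 0, of x 1 0] that mem by auto
    also have "\<dots> = 0"
      using I_form_scale_left[OF g 0, of x x 0] that mem by auto
    finally show ?thesis .
  qed
  have vv: "I_form f ?h v v = b"
    using I_form_transvection_extend[OF 0 0, of 1 1] I_form_scale_left[OF g 0 0 0, of 0] by simp
  have "gram (I_form f ?h) bs = gram (I_form f g) bs"
  proof (rule gram_cong)
    fix x y assume "x \<in> set bs" "y \<in> set bs"
    thus "I_form f ?h x y = I_form f g x y"
      using I_form_transvection_extend[of x y 0 0] mem by auto
  qed
  hence "det (gram (I_form f ?h) (v # bs)) = b * det (gram (I_form f g) bs)"
    using det_gram_Cons[of bs "I_form f ?h" v] v0 vv by simp
  thus "I_disc scale f ?h = quadratic_char b * I_disc scale f g"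
    using quadratic_char_mult[OF two_neq_0 b bs(2)]
    by (simp add: I_disc_eq[OF h vbs] I_disc_eq[OF g bs(1)])
qed

end

section \<open>Product with a transvection whose centre lies in the image of 1 - g\<close>

context
  assumes v: "v \<in> I_space g"
begin

text \<open>In \<open>z = (u - g u) + c *s v\<close> one has \<open>c * b = f (g u) v\<close>, which
  equals \<open>I_form f g v (u - g u)\<close> by the commutator identity. Adding the contribution
  of \<open>c *s v\<close> gives the equation for \<open>c\<close>.\<close>

lemma I_space_transvection_memD:
  assumes "z \<in> I_space (transvection v b \<circ> g)"
  shows "z \<in> I_space g \<and> (\<exists>c. c * (I_form f g v v + b) = I_form f g v z)"
proof -
  obtain u where "z = u - (transvection v b \<circ> g) u" using assms by (rule I_spaceE)
  then obtain c where z: "z = (u - g u) + c *s v" and c: "c * b = f (g u) v"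
    unfolding transvection_comp_diff using b by (metis nonzero_eq_divide_eq)
  have x: "u - g u \<in> I_space g" by simp
  have cv: "c *s v \<in> I_space g" by (rule subspace_scale[OF subspace_I_space[OF g] v])
  have "I_form f g v (u - g u) = I_form f g (u - g u) v - f (u - g u) v"
    unfolding I_form_commutator[OF g x v, symmetric] by simp
  also have "\<dots> = c * b"
    by (simp add: I_form_eq[OF g v] f_diff_left c)
  finally have "I_form f g v z = c * (I_form f g v v + b)"
    unfolding z I_form_add_right[OF g x cv v] I_form_scale_right[OF g v v v]
    by (simp add: algebra_simps)
  moreover have "z \<in> I_space g"
    unfolding z by (rule subspace_add[OF subspace_I_space[OF g] x cv])
  ultimately show ?thesis by metis
qed

text \<open>The same computation backwards: a preimage \<open>u\<close> of \<open>z - c *s v\<close>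
  under 1 - g satisfies \<open>f (g u) v = c * b\<close>, so it is also a preimage of
  \<open>z\<close> for the product.\<close>

lemma I_space_transvection_memI:
  assumes z: "z \<in> I_space g" and c: "c * (I_form f g v v + b) = I_form f g v z"
  shows "z \<in> I_space (transvection v b \<circ> g)"
    and "y \<in> I_space (transvection v b \<circ> g) \<Longrightarrow>
      I_form f (transvection v b \<circ> g) z y = I_form f g z y - c * I_form f g v y"
proof -
  obtain w where w: "v = w - g w" using v by (rule I_spaceE)
  have cv: "c *s v \<in> I_space g" by (rule subspace_scale[OF subspace_I_space[OF g] v])
  have x: "z - c *s v \<in> I_space g" by (rule subspace_diff[OF subspace_I_space[OF g] z cv])
  then obtain u where u: "z - c *s v = u - g u" by (rule I_spaceE)
  have "I_form f g v z = I_form f g v (z - c *s v) + c * I_form f g v v"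
    using I_form_add_right[OF g x cv v] I_form_scale_right[OF g v v v, of c] by simp
  hence "c * b = I_form f g v (z - c *s v)"
    using c by (simp add: algebra_simps)
  also have "\<dots> = I_form f g (z - c *s v) v - f (z - c *s v) v"
    unfolding I_form_commutator[OF g x v, symmetric] by simp
  also have "\<dots> = f (g u) v"
    unfolding u by (simp add: I_form_eq[OF g v] f_diff_left)
  finally have zu: "z = u - (transvection v b \<circ> g) u"
    unfolding transvection_comp_diff using b u by (metis diff_add_cancel nonzero_eq_divide_eq)
  thus "z \<in> I_space (transvection v b \<circ> g)" by (metis I_space_mem)
  assume y: "y \<in> I_space (transvection v b \<circ> g)"
  hence yg: "y \<in> I_space g" using I_space_transvection_memD by blast
  have "I_form f (transvection v b \<circ> g) z y = f u y"
    by (subst zu) (rule I_form_eq[OF isometry_transvection_comp[OF g b] y])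
  \<comment> \<open>Under 1 - g, \<open>u + c *s w\<close> is a preimage of \<open>z\<close> and
    \<open>w\<close> one of \<open>v\<close>, so both terms are values of the old form.\<close>
  also have "\<dots> = f (u + c *s w) y - c * f w y"
    by (simp add: f_linear)
  also have "f w y = I_form f g v y"
    unfolding w by (rule I_form_eq[OF g yg, symmetric])
  also have "f (u + c *s w) y = I_form f g (u + c *s w - g (u + c *s w)) y"
    by (rule I_form_eq[OF g yg, symmetric])
  also have "u + c *s w - g (u + c *s w) = (u - g u) + c *s (w - g w)"
    by (simp add: isometry_linear[OF g] scale_right_diff_distrib)
  also have "\<dots> = z" by (simp add: u[symmetric] w[symmetric])
  finally show "I_form f (transvection v b \<circ> g) z y = I_form f g z y - c * I_form f g v y" .
qed

lemma I_space_transvection_same: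
  assumes B: "I_form f g v v + b \<noteq> 0"
  shows "I_space (transvection v b \<circ> g) = I_space g"
proof (intro equalityI subsetI)
  fix z assume "z \<in> I_space g"
  thus "z \<in> I_space (transvection v b \<circ> g)"
    by (rule I_space_transvection_memI(1)[where c = "I_form f g v z / (I_form f g v v + b)"])
      (use B in simp)
qed (use I_space_transvection_memD in blast)

lemma I_form_transvection_same:
  assumes B: "I_form f g v v + b \<noteq> 0" and "z \<in> I_space g" "y \<in> I_space g"
  shows "I_form f (transvection v b \<circ> g) z y
    = I_form f g z y - inverse (I_form f g v v + b) * I_form f g v z * I_form f g v y"
proof -
  have "I_form f (transvection v b \<circ> g) z y
      = I_form f g z y - I_form f g v z / (I_form f g v v + b) * I_form f g v y"
    by (rule I_space_transvection_memI(2)) (use assms in \<open>simp_all add: I_space_transvection_same\<close>)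
  thus ?thesis by (simp add: divide_inverse mult.commute)
qed

text \<open>A basis starting with \<open>v\<close> makes the rank one update applicable. Its factor
  is \<open>b / B\<close> with \<open>B = I_form f g v v + b\<close>, written as
  \<open>(inverse B)\<^sup>2 * (b * B)\<close> to expose a square.\<close>

lemma I_disc_transvection_same:
  assumes B: "I_form f g v v + b \<noteq> 0" and "v \<noteq> 0"
  shows "I_disc scale f (transvection v b \<circ> g)
    = quadratic_char b * quadratic_char (I_form f g v v + b) * I_disc scale f g"
proof -
  let ?h = "transvection v b \<circ> g" and ?B = "I_form f g v v + b"
  have h: "isometry ?h" by (rule isometry_transvection_comp[OF g b])
  obtain bs where "ordered_basis scale (I_space g) ([v] @ bs)"
    by (rule ordered_basis_exists[OF subspace_I_space[OF g], of "[v]"]) (use v \<open>v \<noteq> 0\<close> in auto)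
  hence bs: "ordered_basis scale (I_space g) (v # bs)" by simp
  hence bs': "ordered_basis scale (I_space ?h) (v # bs)"
    by (simp only: I_space_transvection_same[OF B])
  have "det (gram (I_form f ?h) (v # bs))
      = (1 - inverse ?B * I_form f g v v) * det (gram (I_form f g) (v # bs))"
    by (rule det_gram_rank_one_update)
      (use ordered_basis_mem[OF bs] in \<open>auto intro!: I_form_transvection_same[OF B]\<close>)
  also have "1 - inverse ?B * I_form f g v v = (inverse ?B)\<^sup>2 * (b * ?B)"
  proof -
    have "1 - inverse B * (B - b) = (inverse B)\<^sup>2 * (b * B)" if "B \<noteq> 0" for B
      using that by (simp add: field_simps power2_eq_square)
    from this[OF B] show ?thesis by simp
  qed
  finally have det: "det (gram (I_form f ?h) (v # bs))
      = (inverse ?B)\<^sup>2 * (b * ?B * det (gram (I_form f g) (v # bs)))" by (simp only: mult.assoc)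
  have "inverse ?B \<noteq> 0" "b * ?B \<noteq> 0" using B b by auto
  moreover have "det (gram (I_form f g) (v # bs)) \<noteq> 0"
    by (rule det_gram_nonzero[OF bs bilinear_on_I_form[OF g] I_form_nondegenerate[OF g]])
  ultimately show ?thesis
    unfolding I_disc_eq[OF h bs'] I_disc_eq[OF g bs] det
    using quadratic_char_square_mult quadratic_char_mult[OF two_neq_0] b B by metis
qed

context
  assumes B: "I_form f g v v + b = 0"
begin

text \<open>The equation for \<open>c\<close> now reads \<open>0 = I_form f g v z\<close>, so
  \<open>c = 0\<close> may be chosen; the new form is then a restriction of the old one.\<close>

lemma I_space_transvection_shrink:
  "z \<in> I_space (transvection v b \<circ> g) \<longleftrightarrow> z \<in> I_space g \<and> I_form f g v z = 0"
  using I_space_transvection_memD[of z] I_space_transvection_memI(1)[of z 0] B by auto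

lemma I_form_transvection_shrink:
  assumes "z \<in> I_space (transvection v b \<circ> g)" "y \<in> I_space (transvection v b \<circ> g)"
  shows "I_form f (transvection v b \<circ> g) z y = I_form f g z y"
  using I_space_transvection_memI(2)[of z 0 y] assms B by (simp add: I_space_transvection_shrink)

end

end

end

lemma transvection_cancel:
  assumes "b \<noteq> 0"
  shows "transvection v (- b) \<circ> (transvection v b \<circ> g) = g"
  by (simp add: fun_eq_iff transvection_inverse[OF assms])

text \<open>Since \<open>I_form f g v v = - b\<close> is nonzero, \<open>v\<close> drops out of the
  image space. Multiplying back by the transvection with parameter \<open>- b\<close> is then the
  case of a centre outside.\<close>

lemma
  assumes g: "isometry g" and b: "b \<noteq> 0" and v: "v \<in> I_space g" and B: "I_form f g v v + b = 0"
  shows dim_transvection_shrink: "dim (I_space g) = Suc (dim (I_space (transvection v b \<circ> g)))"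
    and I_disc_transvection_shrink:
      "I_disc scale f g = quadratic_char (- b) * I_disc scale f (transvection v b \<circ> g)"
proof -
  let ?h = "transvection v b \<circ> g"
  have h: "isometry ?h" by (rule isometry_transvection_comp[OF g b])
  have "I_form f g v v \<noteq> 0" using B b by auto
  hence v': "v \<notin> I_space ?h" by (simp add: I_space_transvection_shrink[OF g b v B])
  have "transvection v (- b) \<circ> ?h = g" by (rule transvection_cancel[OF b])
  thus "dim (I_space g) = Suc (dim (I_space ?h))"
    and "I_disc scale f g = quadratic_char (- b) * I_disc scale f ?h"
    using dim_transvection_extend[OF h _ v', of "- b"] I_disc_transvection_extend[OF h _ v', of "- b"] b
    by simp_all
qed

text \<open>If \<open>f\<^sub>h(x,x) \<noteq> 0\<close> for some \<open>x\<close>, a transvection with centre \<open>x\<close> lowers \<open>i(h)\<close>. If \<open>f\<^sub>h\<close> is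
  alternating, any transvection with centre in \<open>I(h)\<close> keeps \<open>i(h)\<close> and destroys this property.\<close>

lemma isometry_induct [consumes 1, case_names id transvection]:
  fixes h :: "'v \<Rightarrow> 'v"
  assumes "isometry h" and "P id"
    and step: "\<And>h v b. isometry h \<Longrightarrow> v \<noteq> 0 \<Longrightarrow> b \<noteq> 0 \<Longrightarrow> P h \<Longrightarrow> P (transvection v b \<circ> h)"
  shows "P h"
  using assms(1)
proof (induction "dim (I_space h)" arbitrary: h rule: less_induct)
  case (less h)
  note h = less.prems
  have reduce: "P k" if k: "isometry k" and dim: "dim (I_space k) = dim (I_space h)"
    and x: "x \<in> I_space k" "I_form f k x x \<noteq> 0" for k x
  proof -
    \<comment> \<open>With this parameter \<open>I_form f k x x + ?b = 0\<close>, the case in which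
      the dimension drops.\<close>
    let ?b = "- I_form f k x x"
    have b: "?b \<noteq> 0" "- ?b \<noteq> 0" using x by auto
    have x0: "x \<noteq> 0" using x I_form_scale_left[OF k x(1,1,1), of 0] by auto
    let ?k' = "transvection x ?b \<circ> k"
    have k': "isometry ?k'" by (rule isometry_transvection_comp[OF k b(1)])
    have "dim (I_space ?k') < dim (I_space h)"
      using dim_transvection_shrink[OF k b(1) x(1)] dim by simp
    hence "P ?k'" using less.hyps k' by blast
    hence "P (transvection x (- ?b) \<circ> ?k')" by (rule step[OF k' x0 b(2)])
    thus ?thesis by (simp only: transvection_cancel[OF b(1)])
  qed
  show ?case
  proof (cases "\<exists>x\<in>I_space h. I_form f h x x \<noteq> 0")
    case True
    thus ?thesis using reduce h by blast
  next
    case alt: False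
    show ?thesis
    proof (cases "\<exists>v\<in>I_space h. v \<noteq> 0")
      case False
      hence "h u = u" for u using I_space_mem[of u h] by (metis eq_iff_diff_eq_0)
      hence "h = id" by (simp add: fun_eq_iff)
      thus ?thesis using assms(2) by simp
    next
      case True
      then obtain v where v: "v \<in> I_space h" "v \<noteq> 0" by blast
      obtain x where x: "x \<in> I_space h" "I_form f h x v \<noteq> 0"
        using I_form_nondegenerate[OF h v(1)] v(2) by blast
      \<comment> \<open>Expanding at \<open>x + v\<close> shows that the alternating form is skew,
        so \<open>I_form f h v x\<close> is nonzero as well.\<close>
      have "I_form f h (x + v) (x + v) = 0"
        using alt subspace_add[OF subspace_I_space[OF h] x(1) v(1)] by blast
      moreover have "I_form f h x x = 0" "I_form f h v v = 0" using alt x v by auto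
      ultimately have vx: "I_form f h v x \<noteq> 0"
        using x(2) subspace_add[OF subspace_I_space[OF h] x(1) v(1)] x(1) v(1)
        by (auto simp: I_form_add_left[OF h] I_form_add_right[OF h])
      let ?k = "transvection v 1 \<circ> h"
      have B: "I_form f h v v + 1 \<noteq> 0" using \<open>I_form f h v v = 0\<close> by simp
      have k: "isometry ?k" by (rule isometry_transvection_comp[OF h]) simp
      have eq: "I_space ?k = I_space h"
        by (rule I_space_transvection_same[OF h _ v(1) B]) simp
      \<comment> \<open>Here \<open>I_form f h v v + 1 = 1\<close> and the old value at
        \<open>x\<close> is zero, so only the rank one term remains.\<close>
      have "I_form f ?k x x = - (I_form f h v x * I_form f h v x)"
        using I_form_transvection_same[OF h _ v(1) B x(1,1)] \<open>I_form f h x x = 0\<close> \<open>I_form f h v v = 0\<close>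
        by simp
      hence "P ?k"
        using reduce[OF k, of x] eq vx x(1) by simp
      hence "P (transvection v (- 1) \<circ> ?k)" by (intro step[OF k v(2)]) simp
      thus ?thesis by (simp only: transvection_cancel[OF one_neq_zero])
    qed
  qed
qed

end

text \<open>Completing the square: the exponent is
  \<open>b * (c - a / b)\<^sup>2 - a\<^sup>2 / b\<close>.\<close>

lemma (in primitive_character) sum_e_quadratic:
  assumes "b \<noteq> 0"
  shows "(\<Sum>c\<in>UNIV. e (b * c\<^sup>2 - 2 * c * a)) = e (- (a\<^sup>2 / b)) * (of_int (quadratic_char b) * \<theta>)"
proof -
  have "(\<Sum>c\<in>UNIV. e (b * c\<^sup>2 - 2 * c * a)) = (\<Sum>c\<in>UNIV. e (- (a\<^sup>2 / b) + b * c\<^sup>2))"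
  proof (rule sum.reindex_bij_witness[of _ "\<lambda>c. c + a / b" "\<lambda>c. c - a / b"])
    fix c
    show "e (- (a\<^sup>2 / b) + b * (c - a / b)\<^sup>2) = e (b * c\<^sup>2 - 2 * c * a)"
      using assms by (intro arg_cong[where f = e]) (simp add: field_simps power2_eq_square)
  qed auto
  also have "\<dots> = e (- (a\<^sup>2 / b)) * (\<Sum>c\<in>UNIV. e (b * c\<^sup>2))"
    by (simp only: e_add sum_distrib_left)
  finally show ?thesis by (simp only: gauss_sum_scaled[OF assms])
qed

section \<open>The identity and single transvections\<close>

context symplectic
begin

lemma I_space_id [simp]: "I_space id = {0}"
  by (auto simp: I_space_def)

lemma ordered_basis_zero: "ordered_basis scale {0} []"
  by (simp add: ordered_basis_def independent_empty)

lemma dim_zero [simp]: "dim {0} = 0"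
  using ordered_basis_length[OF ordered_basis_zero] by simp

lemma I_disc_id [simp]: "I_disc scale f id = 1"
  using I_disc_eq[OF isometry_id, of "[]"] by (simp add: ordered_basis_zero gram_def)

lemma I_disc_square: "I_disc scale f g * I_disc scale f g = 1"
  unfolding I_disc_def Let_def by (rule quadratic_char_times_self)

text \<open>A transvection is its product with \<open>id\<close>, whose image space is zero, so a
  nonzero \<open>v\<close> falls under the case of a centre outside.\<close>

lemma I_space_transvection:
  assumes "b \<noteq> 0" "v \<noteq> 0"
  shows "I_space (transvection v b) = range (\<lambda>c. c *s v)"
  using I_space_transvection_extend[OF isometry_id assms(1), of v] assms(2) by auto

lemma I_form_transvection:
  assumes "b \<noteq> 0" "v \<noteq> 0"
  shows "I_form f (transvection v b) (c *s v) (c *s v) = b * c\<^sup>2"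
  using I_form_transvection_extend[OF isometry_id assms(1), of v 0 0 c c] assms(2)
    I_form_scale_left[OF isometry_id, of 0 0 0 0]
  by (simp add: power2_eq_square mult_ac)

lemma
  assumes "b \<noteq> 0" "v \<noteq> 0"
  shows dim_transvection: "dim (I_space (transvection v b)) = 1"
    and I_disc_transvection: "I_disc scale f (transvection v b) = quadratic_char b"
  using dim_transvection_extend[OF isometry_id assms(1), of v] assms(2)
    I_disc_transvection_extend[OF isometry_id assms(1), of v] by simp_all

end

section \<open>The normalised operators\<close>

text \<open>\<open>T x\<close> stands for \<open>\<rho> (x, 0)\<close>. Maps act on the right, so
  \<open>T y (T x w)\<close> is the product taken first \<open>x\<close>, then \<open>y\<close>;
  hence the factor \<open>e (f x y)\<close>.\<close>

locale heisenberg_operators =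
  V: symplectic scaleV f + primitive_character \<epsilon> p + W: vector_space scaleW
  for scaleV :: "'p::prime_card mod_ring \<Rightarrow> 'v::ab_group_add \<Rightarrow> 'v" (infixr "*v" 75)
    and f :: "'v \<Rightarrow> 'v \<Rightarrow> 'p mod_ring" and \<epsilon> :: "'k::field" and p :: "'p itself"
    and scaleW :: "'k \<Rightarrow> 'w::ab_group_add \<Rightarrow> 'w" (infixr "*w" 75) +
  fixes T :: "'v \<Rightarrow> 'w \<Rightarrow> 'w"
  assumes T_linear: "Vector_Spaces.linear scaleW scaleW (T x)"
    and T_0: "T 0 w = w"
    and T_comp: "T y (T x w) = e (f x y) *w T (x + y) w"
begin

lemma T_add: "T x (w + w') = T x w + T x w'"
  and T_scale: "T x (c *w w) = c *w T x w"
  using T_linear[of x] unfolding Vector_Spaces.linear_iff by blast+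

lemma T_sum: "finite A \<Longrightarrow> T x (\<Sum>a\<in>A. h a) = (\<Sum>a\<in>A. T x (h a))"
proof (induction A rule: finite_induct)
  case empty
  show ?case using T_scale[of x 0 0] by simp
qed (simp add: T_add)

definition Op :: "('v \<Rightarrow> 'k) \<Rightarrow> 'w \<Rightarrow> 'w" where
  "Op a w = (\<Sum>x\<in>UNIV. a x *w T x w)"

text \<open>The product of the twisted group algebra. Its twist is \<open>e (f (z - y) y)\<close>,
  shortened by \<open>f y y = 0\<close>.\<close>

definition twisted_conv :: "('v \<Rightarrow> 'k) \<Rightarrow> ('v \<Rightarrow> 'k) \<Rightarrow> 'v \<Rightarrow> 'k" where
  "twisted_conv a b z = (\<Sum>y\<in>UNIV. a (z - y) * b y * e (f z y))"

lemma Op_comp: "Op b (Op a w) = Op (twisted_conv a b) w"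
proof -
  have "Op b (Op a w) = (\<Sum>y\<in>UNIV. \<Sum>x\<in>UNIV. (a x * b y * e (f x y)) *w T (x + y) w)"
    by (simp add: Op_def T_sum T_scale T_comp W.scale_sum_right mult_ac)
  also have "\<dots> = (\<Sum>y\<in>UNIV. \<Sum>z\<in>UNIV. (a (z - y) * b y * e (f z y)) *w T z w)"
  proof (rule sum.cong[OF refl])
    fix y
    show "(\<Sum>x\<in>UNIV. (a x * b y * e (f x y)) *w T (x + y) w)
        = (\<Sum>z\<in>UNIV. (a (z - y) * b y * e (f z y)) *w T z w)"
      by (rule sum.reindex_bij_witness[of _ "\<lambda>z. z - y" "\<lambda>x. x + y"]) (auto simp: V.f_add_left)
  qed
  also have "\<dots> = Op (twisted_conv a b) w"
    by (subst sum.swap) (simp add: Op_def twisted_conv_def W.scale_sum_left)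
  finally show ?thesis .
qed

text \<open>The coefficients of \<open>s(g) / \<mu>(g)\<close>, in which the factor \<open>|I(g)|\<close> has cancelled.\<close>

definition S_coeff :: "('v \<Rightarrow> 'v) \<Rightarrow> 'v \<Rightarrow> 'k" where
  "S_coeff g x = (if x \<in> I_space g
     then of_int (I_disc scaleV f g) * inverse \<theta> ^ V.dim (I_space g) * e (I_form f g x x) else 0)"

lemma S_coeff_mem: "x \<in> I_space g \<Longrightarrow>
    S_coeff g x = of_int (I_disc scaleV f g) * inverse \<theta> ^ V.dim (I_space g) * e (I_form f g x x)"
  and S_coeff_notmem: "x \<notin> I_space g \<Longrightarrow> S_coeff g x = 0"
  by (simp_all add: S_coeff_def)

section \<open>Multiplying a normalised operator by that of a transvection\<close>

context
  fixes g :: "'v \<Rightarrow> 'v" and v :: 'v and b :: "'p mod_ring"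
  assumes g: "V.isometry g" and b: "b \<noteq> 0" and v0: "v \<noteq> 0"
begin

text \<open>The second factor is supported on the line spanned by \<open>v\<close>, parametrised
  here by \<open>c\<close>, and its form there is \<open>b * c\<^sup>2\<close>.\<close>

lemma twisted_conv_transvection:
  "twisted_conv (S_coeff g) (S_coeff (V.transvection v b)) z
    = of_int (quadratic_char b) * inverse \<theta>
      * (\<Sum>c\<in>UNIV. S_coeff g (z - c *v v) * e (b * c\<^sup>2 + c * f z v))"
proof -
  let ?t = "V.transvection v b"
  have inj: "inj (\<lambda>c. c *v v)" using v0 by (auto simp: inj_def)
  have "twisted_conv (S_coeff g) (S_coeff ?t) z
      = (\<Sum>y\<in>range (\<lambda>c. c *v v). S_coeff g (z - y) * S_coeff ?t y * e (f z y))"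
    unfolding twisted_conv_def
    by (rule sum.mono_neutral_right)
      (auto simp: V.I_space_transvection[OF b v0] S_coeff_notmem)
  also have "\<dots> = (\<Sum>c\<in>UNIV. S_coeff g (z - c *v v) * S_coeff ?t (c *v v) * e (f z (c *v v)))"
    by (subst sum.reindex[OF inj]) simp
  also have "\<dots> = (\<Sum>c\<in>UNIV. of_int (quadratic_char b) * inverse \<theta>
      * (S_coeff g (z - c *v v) * e (b * c\<^sup>2 + c * f z v)))"
  proof (rule sum.cong[OF refl])
    fix c
    have "c *v v \<in> I_space ?t" unfolding V.I_space_transvection[OF b v0] by (rule rangeI)
    hence "S_coeff ?t (c *v v) = of_int (quadratic_char b) * inverse \<theta> * e (b * c\<^sup>2)"
      by (simp only: S_coeff_mem V.I_form_transvection[OF b v0] V.dim_transvection[OF b v0]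
          V.I_disc_transvection[OF b v0] power_one_right)
    thus "S_coeff g (z - c *v v) * S_coeff ?t (c *v v) * e (f z (c *v v))
        = of_int (quadratic_char b) * inverse \<theta> * (S_coeff g (z - c *v v) * e (b * c\<^sup>2 + c * f z v))"
      by (simp add: e_add V.f_scale_right mult_ac)
  qed
  finally show ?thesis by (simp add: sum_distrib_left)
qed

text \<open>For \<open>z = x + c\<^sub>0 *v v\<close> only \<open>c = c\<^sub>0\<close> brings
  \<open>z - c *v v\<close> into \<open>I_space g\<close>, so a single term survives.\<close>

lemma twisted_conv_outside:
  assumes v: "v \<notin> I_space g"
  shows "twisted_conv (S_coeff g) (S_coeff (V.transvection v b)) = S_coeff (V.transvection v b \<circ> g)"
proof
  fix z
  let ?h = "V.transvection v b \<circ> g"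
  note sub = V.subspace_I_space[OF g]
  show "twisted_conv (S_coeff g) (S_coeff (V.transvection v b)) z = S_coeff ?h z"
  proof (cases "z \<in> I_space ?h")
    case False
    have "z - c *v v \<notin> I_space g" for c
      using False unfolding V.I_space_transvection_extend[OF g b v] by (auto simp: algebra_simps)
        (metis diff_add_cancel)
    thus ?thesis
      using False by (simp add: twisted_conv_transvection S_coeff_notmem)
  next
    case True
    then obtain x c\<^sub>0 where x: "x \<in> I_space g" and z: "z = x + c\<^sub>0 *v v"
      unfolding V.I_space_transvection_extend[OF g b v] by blast
    have out: "z - c *v v \<notin> I_space g" if "c \<noteq> c\<^sub>0" for c
    proof
      assume "z - c *v v \<in> I_space g"
      from V.subspace_diff[OF sub this x] have "(c\<^sub>0 - c) *v v \<in> I_space g"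
        by (simp add: z V.scale_left_diff_distrib)
      from V.subspace_scale[OF sub this, of "inverse (c\<^sub>0 - c)"] show False
        using that v by simp
    qed
    have "(\<Sum>c\<in>UNIV. S_coeff g (z - c *v v) * e (b * c\<^sup>2 + c * f z v))
        = (\<Sum>c\<in>{c\<^sub>0}. S_coeff g (z - c *v v) * e (b * c\<^sup>2 + c * f z v))"
      by (rule sum.mono_neutral_right) (auto simp: out S_coeff_notmem)
    also have "\<dots> = S_coeff g x * e (b * c\<^sub>0\<^sup>2 + c\<^sub>0 * f x v)"
      by (simp add: z V.f_add_left V.f_scale_left)
    finally have "twisted_conv (S_coeff g) (S_coeff (V.transvection v b)) z
        = of_int (quadratic_char b) * inverse \<theta> * (S_coeff g x * e (b * c\<^sub>0\<^sup>2 + c\<^sub>0 * f x v))"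
      by (simp only: twisted_conv_transvection)
    moreover have "I_form f ?h z z = I_form f g x x + (b * c\<^sub>0\<^sup>2 + c\<^sub>0 * f x v)"
      unfolding z V.I_form_transvection_extend[OF g b v x x]
      by (simp add: algebra_simps power2_eq_square)
    ultimately show ?thesis
      by (simp add: S_coeff_mem True x V.dim_transvection_extend[OF g b v]
          V.I_disc_transvection_extend[OF g b v] e_add mult_ac)
  qed
qed

text \<open>For \<open>z\<close> in \<open>I_space g\<close> every \<open>c\<close> contributes. If
  \<open>?B\<close> is nonzero, the Gauss sum supplies the new term in the form, the sign of
  \<open>?B\<close>, and a factor \<theta> that keeps the exponent. If \<open>?B = 0\<close>, the
  sum is linear in the exponent and tests \<open>?a = 0\<close>.\<close>

lemma twisted_conv_inside:
  assumes v: "v \<in> I_space g"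
  shows "twisted_conv (S_coeff g) (S_coeff (V.transvection v b)) = S_coeff (V.transvection v b \<circ> g)"
proof
  fix z
  let ?h = "V.transvection v b \<circ> g" and ?B = "I_form f g v v + b"
  note sub = V.subspace_I_space[OF g]
  have shift: "z - c *v v \<in> I_space g \<longleftrightarrow> z \<in> I_space g" for c
    using V.subspace_diff[OF sub _ V.subspace_scale[OF sub v, of c], of z]
      V.subspace_add[OF sub _ V.subspace_scale[OF sub v, of c], of "z - c *v v"]
    by (metis diff_add_cancel)
  show "twisted_conv (S_coeff g) (S_coeff (V.transvection v b)) z = S_coeff ?h z"
  proof (cases "z \<in> I_space g")
    case False
    hence "z \<notin> I_space ?h" using V.I_space_transvection_memD[OF g b v] by blast
    thus ?thesis
      using False by (simp add: twisted_conv_transvection S_coeff_notmem shift)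
  next
    case z: True
    let ?a = "I_form f g v z"
    \<comment> \<open>The commutator identity turns \<open>f z v\<close> into a difference of Wall
      form values: the terms in \<open>I_form f g z v\<close> cancel and those in \<open>?a\<close>
      double.\<close>
    have expand: "I_form f g (z - c *v v) (z - c *v v) + (b * c\<^sup>2 + c * f z v)
        = I_form f g z z + (?B * c\<^sup>2 - 2 * c * ?a)" for c
    proof -
      have cv: "- c *v v \<in> I_space g" and zc: "z + - c *v v \<in> I_space g"
        using V.subspace_scale[OF sub v, of "- c"] shift[of c] z by auto
      have "I_form f g (z + - c *v v) (z + - c *v v)
          = I_form f g z z - c * I_form f g z v - c * ?a + c\<^sup>2 * I_form f g v v"
        by (simp only: V.I_form_add_left[OF g z cv zc] V.I_form_add_right[OF g z cv z]
            V.I_form_add_right[OF g z cv cv] V.I_form_scale_left[OF g v _ v]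
            V.I_form_scale_left[OF g v z v] V.I_form_scale_right[OF g z v v]
            V.I_form_scale_left[OF g v cv v] V.I_form_scale_right[OF g v v v])
          (simp add: algebra_simps power2_eq_square)
      hence form: "I_form f g (z - c *v v) (z - c *v v)
          = I_form f g z z - c * I_form f g z v - c * ?a + c\<^sup>2 * I_form f g v v" by simp
      show ?thesis
        unfolding form V.I_form_commutator[OF g z v, symmetric] by (simp add: algebra_simps)
    qed
    have "S_coeff g (z - c *v v) * e (b * c\<^sup>2 + c * f z v) = S_coeff g z * e (?B * c\<^sup>2 - 2 * c * ?a)" for c
    proof -
      have "S_coeff g (z - c *v v) * e (b * c\<^sup>2 + c * f z v)
          = of_int (I_disc scaleV f g) * inverse \<theta> ^ V.dim (I_space g)
            * e (I_form f g (z - c *v v) (z - c *v v) + (b * c\<^sup>2 + c * f z v))"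
        by (simp add: S_coeff_mem shift z e_add)
      thus ?thesis by (simp only: expand) (simp add: S_coeff_mem z e_add)
    qed
    hence conv: "twisted_conv (S_coeff g) (S_coeff (V.transvection v b)) z
        = of_int (quadratic_char b) * inverse \<theta>
          * (S_coeff g z * (\<Sum>c\<in>UNIV. e (?B * c\<^sup>2 - 2 * c * ?a)))"
      by (simp only: twisted_conv_transvection sum_distrib_left)
    show ?thesis
    proof (cases "?B = 0")
      case False
      have zh: "z \<in> I_space ?h" using z V.I_space_transvection_same[OF g b v False] by simp
      have "I_form f ?h z z = I_form f g z z + - (?a\<^sup>2 / ?B)"
        using V.I_form_transvection_same[OF g b v False z z]
        by (simp add: power2_eq_square divide_inverse mult_ac)
      hence "e (I_form f ?h z z) = e (I_form f g z z) * e (- (?a\<^sup>2 / ?B))" by (simp only: e_add)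
      thus ?thesis
        unfolding conv sum_e_quadratic[OF False] S_coeff_mem[OF zh] S_coeff_mem[OF z]
          V.I_space_transvection_same[OF g b v False] V.I_disc_transvection_same[OF g b v False v0]
        by simp
    next
      case True
      have "(\<Sum>c\<in>UNIV. e (?B * c\<^sup>2 - 2 * c * ?a)) = (\<Sum>c\<in>UNIV. e (- 2 * ?a * c))"
        by (rule sum.cong) (simp_all add: True mult_ac)
      also have "\<dots> = (if ?a = 0 then of_nat CARD('p) else 0)"
        unfolding sum_e_mult by simp
      finally have sum: "(\<Sum>c\<in>UNIV. e (?B * c\<^sup>2 - 2 * c * ?a)) = (if ?a = 0 then of_nat CARD('p) else 0)" .
      show ?thesis
      proof (cases "?a = 0")
        case False
        hence "z \<notin> I_space ?h" by (simp add: V.I_space_transvection_shrink[OF g b v True])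
        thus ?thesis unfolding conv sum using False by (simp add: S_coeff_notmem)
      next
        case a: True
        have zh: "z \<in> I_space ?h" using z a by (simp add: V.I_space_transvection_shrink[OF g b v True])
        let ?\<chi> = "\<lambda>t :: 'p mod_ring. of_int (quadratic_char t) :: 'k"
        have "quadratic_char (- b) = quadratic_char (- 1 :: 'p mod_ring) * quadratic_char b"
          using quadratic_char_mult[OF two_neq_0, of "- 1" b] b by simp
        hence neg: "?\<chi> (- b) = ?\<chi> (- 1) * ?\<chi> b" by simp
        have "?\<chi> b * ?\<chi> b = 1" and sq: "?\<chi> (- 1) * ?\<chi> (- 1) = 1"
          by (simp_all only: of_int_mult[symmetric] quadratic_char_times_self of_int_1)
        hence \<chi>: "?\<chi> b * ?\<chi> (- b) = ?\<chi> (- 1)"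
          by (simp add: neg mult.left_commute)
        \<comment> \<open>Rewriting the cardinality through \<open>\<theta>\<^sup>2\<close> cancels
          the inverse \<theta> of the transvection and one more, matching the drop in dimension; the
          three signs multiply to 1.\<close>
        have "of_nat CARD('p) = ?\<chi> (- 1) * (?\<chi> (- 1) * of_nat CARD('p))"
          by (simp only: mult.assoc[symmetric] sq mult_1)
        hence card: "of_nat CARD('p) = ?\<chi> (- 1) * \<theta>\<^sup>2" by (simp only: gauss_sum_square)
        have \<theta>: "inverse \<theta> * inverse \<theta> * \<theta>\<^sup>2 = 1" by (simp add: power2_eq_square field_simps)
        have "?\<chi> b * inverse \<theta> * (S_coeff g z * of_nat CARD('p))
            = (?\<chi> b * ?\<chi> (- b) * ?\<chi> (- 1)) * (inverse \<theta> * inverse \<theta> * \<theta>\<^sup>2) * S_coeff ?h z"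
          unfolding S_coeff_mem[OF zh] S_coeff_mem[OF z] V.dim_transvection_shrink[OF g b v True]
            V.I_disc_transvection_shrink[OF g b v True] V.I_form_transvection_shrink[OF g b v True zh zh]
            card of_int_mult power_Suc
          by (simp only: mult_ac)
        hence "?\<chi> b * inverse \<theta> * (S_coeff g z * of_nat CARD('p)) = S_coeff ?h z"
          by (simp only: \<chi> sq \<theta> mult_1)
        thus ?thesis unfolding conv sum using a by simp
      qed
    qed
  qed
qed

lemma twisted_conv_S_coeff:
  "twisted_conv (S_coeff g) (S_coeff (V.transvection v b)) = S_coeff (V.transvection v b \<circ> g)"
  using twisted_conv_inside twisted_conv_outside by blast

end

lemma Op_S_coeff_id: "Op (S_coeff id) w = w"
proof -
  have "I_form f id 0 0 = 0"
    using V.I_form_scale_left[OF V.isometry_id, of 0 0 0 0] by simp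
  hence "S_coeff id x *w T x w = (if x = 0 then T 0 w else 0)" for x
    by (cases "x = 0") (simp_all only: S_coeff_def V.I_space_id singleton_iff V.dim_zero V.I_disc_id, simp_all)
  thus ?thesis
    unfolding Op_def by (simp only: sum.delta V.finite_sets) (simp add: T_0)
qed

text \<open>Induction on \<open>h\<close> peels off one transvection at a time. \<open>Op\<close>
  turns twisted convolution into composition, so associativity finishes each step.\<close>

lemma Op_S_coeff_comp:
  assumes "V.isometry h" "V.isometry g"
  shows "Op (S_coeff h) (Op (S_coeff g) w) = Op (S_coeff (h \<circ> g)) w"
  using assms
proof (induction h arbitrary: g w rule: V.isometry_induct)
  case id
  show ?case by (simp only: Op_S_coeff_id id_comp)
next
  case (transvection h v b)
  note step = twisted_conv_S_coeff[OF _ \<open>b \<noteq> 0\<close> \<open>v \<noteq> 0\<close>, symmetric]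
  have "Op (S_coeff (V.transvection v b \<circ> h)) (Op (S_coeff g) w)
      = Op (S_coeff (V.transvection v b)) (Op (S_coeff h) (Op (S_coeff g) w))"
    by (simp only: step[OF \<open>V.isometry h\<close>] Op_comp[symmetric])
  also have "\<dots> = Op (S_coeff (V.transvection v b)) (Op (S_coeff (h \<circ> g)) w)"
    by (simp only: transvection.IH[OF \<open>V.isometry g\<close>])
  also have "\<dots> = Op (S_coeff (V.transvection v b \<circ> (h \<circ> g))) w"
    by (simp only: step[OF V.isometry_comp[OF \<open>V.isometry g\<close> \<open>V.isometry h\<close>]] Op_comp[symmetric])
  finally show ?case by (simp only: comp_assoc)
qed

section \<open>The average s(g), the scalar \<mu>(g) and inverses\<close>

abbreviation \<mu> :: "('v \<Rightarrow> 'v) \<Rightarrow> 'k" where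
  "\<mu> \<equiv> \<mu>_fun scaleV f \<epsilon>"

lemma card_subspace_nonzero: "V.subspace U \<Longrightarrow> of_nat (card U) \<noteq> (0::'k)"
  using of_nat_p_nonzero by (simp add: V.card_subspace)

text \<open>The powers of \<theta> and the sign cancel, leaving the coefficients of s(g).\<close>

lemma \<mu>_S_coeff:
  assumes "x \<in> I_space g"
  shows "\<mu> g * S_coeff g x = inverse (of_nat (card (I_space g))) * e (I_form f g x x)"
proof -
  have 1: "\<theta> ^ n * inverse \<theta> ^ n = 1" for n
    by (simp add: power_mult_distrib[symmetric])
  have 2: "of_int (I_disc scaleV f g) * of_int (I_disc scaleV f g) = (1::'k)"
    by (simp only: of_int_mult[symmetric] V.I_disc_square of_int_1)
  have "a * t * d * (d * t' * x) = a * (t * t') * (d * d) * x" for a t d t' x :: 'k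
    by (simp only: mult_ac)
  thus ?thesis
    unfolding \<mu>_fun_def \<theta>_def[symmetric] S_coeff_mem[OF assms] by (simp only: 1 2 mult_1_right)
qed

lemma \<mu>_nonzero:
  assumes "V.isometry g"
  shows "\<mu> g \<noteq> 0"
proof
  assume "\<mu> g = 0"
  hence "inverse (of_nat (card (I_space g))) * e (I_form f g 0 0) = 0"
    using \<mu>_S_coeff[of 0 g] V.subspace_0[OF V.subspace_I_space[OF assms]] by simp
  thus False using card_subspace_nonzero[OF V.subspace_I_space[OF assms]] by simp
qed

text \<open>Group the \<open>y\<close> by \<open>x = y - g y\<close>. Each fibre is a coset of the
  fixed space, of size \<open>N\<close> with \<open>CARD('v) = card (I_space g) * N\<close>, and on
  it the summand depends only on \<open>x\<close>.\<close>

lemma average_eq: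
  assumes g: "V.isometry g"
  shows "inverse (of_nat CARD('v)) *w (\<Sum>y\<in>UNIV. T (- g y) (T y w)) = \<mu> g *w Op (S_coeff g) w"
proof -
  define N where "N = card {k. g k = k}"
  have fib: "card {y \<in> UNIV. y - g y = x} = N" if x: "x \<in> I_space g" for x
  proof -
    obtain u where u: "x = u - g u" using x by (rule V.I_spaceE)
    have "{y \<in> UNIV. y - g y = x} = (\<lambda>k. u + k) ` {k. g k = k}"
    proof (intro equalityI subsetI)
      fix y assume "y \<in> {y \<in> UNIV. y - g y = x}"
      hence "g (y - u) = y - u" unfolding V.isometry_diff[OF g] by (simp add: u algebra_simps)
      thus "y \<in> (\<lambda>k. u + k) ` {k. g k = k}" by (intro image_eqI[of _ _ "y - u"]) auto
    qed (auto simp: u V.isometry_add[OF g])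
    thus ?thesis by (simp add: N_def card_image)
  qed
  have range: "(\<lambda>y. y - g y) ` UNIV = I_space g" by (simp add: I_space_def)
  have sum_fib: "(\<Sum>y\<in>UNIV. h (y - g y)) = (\<Sum>x\<in>I_space g. of_nat N *w h x)" for h :: "'v \<Rightarrow> 'w"
  proof -
    have "(\<Sum>y\<in>UNIV. h (y - g y)) = (\<Sum>x\<in>I_space g. \<Sum>y\<in>{y \<in> UNIV. y - g y = x}. h (y - g y))"
      using sum.image_gen[of UNIV "\<lambda>y. h (y - g y)" "\<lambda>y. y - g y"] by (simp add: range)
    also have "\<dots> = (\<Sum>x\<in>I_space g. \<Sum>y\<in>{y \<in> UNIV. y - g y = x}. h x)"
      by (intro sum.cong) auto
    finally show ?thesis by (simp add: W.sum_constant_scale fib[simplified])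
  qed
  have "CARD('v) = (\<Sum>x\<in>I_space g. card {y \<in> UNIV. y - g y = x})"
    using sum.image_gen[of UNIV "\<lambda>_. 1::nat" "\<lambda>y. y - g y"] by (simp add: range)
  hence "CARD('v) = card (I_space g) * N" by (simp add: fib[simplified])
  moreover have "of_nat CARD('v) \<noteq> (0::'k)"
    using card_subspace_nonzero[of UNIV] by simp
  ultimately have scalar: "inverse (of_nat CARD('v)) * of_nat N = (inverse (of_nat (card (I_space g))) :: 'k)"
    by (simp add: field_simps)
  \<comment> \<open>As \<open>f y y = 0\<close>, the exponent \<open>f y (- g y)\<close> equals
    \<open>f y (y - g y)\<close>, a value of the Wall form.\<close>
  have "T (- g y) (T y w) = e (I_form f g (y - g y) (y - g y)) *w T (y - g y) w" for y
    by (simp add: T_comp V.I_form_eq[OF g] V.f_diff_right V.f_minus_right)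
  hence "(\<Sum>y\<in>UNIV. T (- g y) (T y w))
      = (\<Sum>x\<in>I_space g. of_nat N *w (e (I_form f g x x) *w T x w))"
    using sum_fib[of "\<lambda>x. e (I_form f g x x) *w T x w"] by simp
  hence "inverse (of_nat CARD('v)) *w (\<Sum>y\<in>UNIV. T (- g y) (T y w))
      = (\<Sum>x\<in>I_space g. (inverse (of_nat CARD('v)) * of_nat N * e (I_form f g x x)) *w T x w)"
    by (simp add: W.scale_sum_right mult.assoc)
  also have "\<dots> = (\<Sum>x\<in>I_space g. (\<mu> g * S_coeff g x) *w T x w)"
    by (rule sum.cong) (simp_all add: scalar \<mu>_S_coeff)
  also have "\<dots> = (\<Sum>x\<in>UNIV. (\<mu> g * S_coeff g x) *w T x w)"
    by (rule sum.mono_neutral_left) (auto simp: S_coeff_notmem)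
  finally show ?thesis by (simp add: Op_def W.scale_sum_right)
qed

text \<open>The Wall form of \<open>g\<^sup>-\<^sup>1\<close> is \<open>(x, y) \<mapsto> - f\<^sub>g(y, x)\<close>.\<close>

lemma
  assumes g: "V.isometry g" and g': "V.isometry g'" and inv: "g' \<circ> g = id" "g \<circ> g' = id"
  shows I_space_inverse: "I_space g' = I_space g"
    and I_disc_inverse: "I_disc scaleV f g'
      = quadratic_char (- 1 :: 'p mod_ring) ^ V.dim (I_space g) * I_disc scaleV f g"
proof -
  have g'g: "g' (g u) = u" "g (g' u) = u" for u using inv by (simp_all add: fun_eq_iff)
  \<comment> \<open>So \<open>- g u\<close> is a preimage under 1 - g' of the element whose preimage
    under 1 - g is \<open>u\<close>.\<close>
  have neg: "u - g u = (- g u) - g' (- g u)" for u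
    using V.isometry_scale[OF g', of "- 1" "g u"] by (simp add: g'g)
  have neg': "u - g' u = (- g' u) - g (- g' u)" for u
    using V.isometry_scale[OF g, of "- 1" "g' u"] by (simp add: g'g)
  show eq: "I_space g' = I_space g"
    using neg neg' unfolding I_space_def by blast
  have form: "I_form f g' x y = - I_form f g y x" if x: "x \<in> I_space g" and y: "y \<in> I_space g" for x y
  proof -
    obtain u where u: "x = u - g u" using x by (rule V.I_spaceE)
    have "I_form f g' x y = f (- g u) y"
      unfolding u by (subst neg) (rule V.I_form_eq[OF g'], use y eq in simp)
    also have "\<dots> = f (u - g u) y - f u y" by (simp add: V.f_linear V.f_minus_left)
    also have "\<dots> = f x y - I_form f g x y" by (simp add: u V.I_form_eq[OF g y])
    also have "\<dots> = - I_form f g y x" by (simp add: V.I_form_commutator[OF g x y, symmetric])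
    finally show ?thesis .
  qed
  obtain bs where bs: "ordered_basis scaleV (I_space g) bs" and nz: "det (gram (I_form f g) bs) \<noteq> 0"
    using V.I_form_basis_exists[OF g] .
  let ?m = "length bs"
  have "gram (I_form f g') bs = (- 1) \<cdot>\<^sub>m transpose_mat (gram (I_form f g) bs)"
    by (rule eq_matI) (auto simp: gram_def form V.ordered_basis_nth_mem[OF bs])
  hence det: "det (gram (I_form f g') bs) = (- 1) ^ ?m * det (gram (I_form f g) bs)"
    by (simp add: det_smult det_transpose[OF gram_carrier] carrier_matD(1)[OF gram_carrier])
  have "quadratic_char ((- 1) ^ n * t) = quadratic_char (- 1 :: 'p mod_ring) ^ n * quadratic_char t"
    if "t \<noteq> 0" for n and t :: "'p mod_ring"
  proof (induction n)
    case (Suc n)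
    have "quadratic_char (- 1 * ((- 1) ^ n * t)) = quadratic_char (- 1 :: 'p mod_ring) * quadratic_char ((- 1) ^ n * t)"
      by (rule quadratic_char_mult[OF two_neq_0]) (use that in auto)
    thus ?case using Suc by (simp add: mult_ac)
  qed simp
  thus "I_disc scaleV f g'
      = quadratic_char (- 1 :: 'p mod_ring) ^ V.dim (I_space g) * I_disc scaleV f g"
    using V.I_disc_eq[OF g', of bs] V.I_disc_eq[OF g bs] bs eq nz
    by (simp add: det V.ordered_basis_length[OF bs])
qed

end

text \<open>Evaluates the inverse directly from its definition, so that \<open>GL\<close> and
  \<open>Sp\<close> can be handled without first setting up their group structure.\<close>

lemma m_inv_comp_eqI:
  assumes "monoid.mult G = (\<lambda>S T. T \<circ> S)" "one G = id"
    and "S \<in> carrier G" "T \<circ> S = id" "S \<circ> T = id"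
  shows "inv\<^bsub>G\<^esub> T = S"
  unfolding m_inv_def
proof (rule the_equality)
  show "S \<in> carrier G \<and> T \<otimes>\<^bsub>G\<^esub> S = \<one>\<^bsub>G\<^esub> \<and> S \<otimes>\<^bsub>G\<^esub> T = \<one>\<^bsub>G\<^esub>"
    using assms by simp
next
  fix R assume "R \<in> carrier G \<and> T \<otimes>\<^bsub>G\<^esub> R = \<one>\<^bsub>G\<^esub> \<and> R \<otimes>\<^bsub>G\<^esub> T = \<one>\<^bsub>G\<^esub>"
  hence "R \<circ> T = id" using assms(1,2) by simp
  hence "R \<circ> T \<circ> S = S" by simp
  thus "R = S" using assms(4) by (simp only: comp_assoc comp_id)
qed

context symplectic
begin

lemma mult_Sp: "g \<otimes>\<^bsub>Sp scale f\<^esub> h = h \<circ> g"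
  by (simp add: Sp_def GL_def)

lemma isometry_inverse_exists:
  assumes g: "isometry g"
  obtains g' where "isometry g'" "g' \<circ> g = id" "g \<circ> g' = id" "inv\<^bsub>Sp scale f\<^esub> g = g'"
proof -
  let ?g' = "inv_into UNIV g"
  have "bij g" using g by (simp add: isometry_def)
  hence left: "?g' (g x) = x" and right: "g (?g' x) = x" for x
    by (simp_all add: bij_is_inj bij_is_surj surj_f_inv_f)
  have "?g' (x + y) = ?g' x + ?g' y" "?g' (c *s x) = c *s ?g' x" for x y c
    using isometry_add[OF g, of "?g' x" "?g' y"] isometry_scale[OF g, of c "?g' x"] left right
    by metis+
  moreover have "f (?g' x) (?g' y) = f x y" for x y
    using isometry_f[OF g, of "?g' x" "?g' y"] right by simp
  ultimately have g': "isometry ?g'"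
    using vector_space_axioms bij_imp_bij_inv[OF \<open>bij g\<close>]
    by (simp add: isometry_def Vector_Spaces.linear_iff)
  have comp: "?g' \<circ> g = id" "g \<circ> ?g' = id" by (simp_all add: fun_eq_iff left right)
  have "inv\<^bsub>Sp scale f\<^esub> g = ?g'"
    by (rule m_inv_comp_eqI) (use g' comp in \<open>simp_all only: carrier_Sp mem_Collect_eq\<close>, simp_all add: Sp_def GL_def)
  thus ?thesis using that g' comp by blast
qed

end

section \<open>The factor set\<close>

context heisenberg_operators
begin

lemma T_inverse: "T (- x) (T x w) = w"
  by (simp add: T_comp V.f_minus_right T_0)

lemma T_in_GL: "T x \<in> carrier (GL scaleW)"
proof -
  have "bij (T x)"
    by (rule o_bij[where g = "T (- x)"])
      (use T_inverse[of x] T_inverse[of "- x"] in \<open>auto simp: fun_eq_iff\<close>)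
  thus ?thesis by (simp add: GL_def T_linear)
qed

lemma inv_T: "inv\<^bsub>GL scaleW\<^esub> T x = T (- x)"
  by (rule m_inv_comp_eqI)
    (use T_inverse[of x] T_inverse[of "- x"] T_in_GL in \<open>auto simp: fun_eq_iff GL_def\<close>)

context
  fixes \<rho> :: "'v \<times> 'p mod_ring \<Rightarrow> 'w \<Rightarrow> 'w"
  assumes \<rho>: "\<rho> (x, 0) = T x"
begin

lemma s_op_eq:
  assumes "V.isometry g"
  shows "s_op scaleW \<rho> g w = \<mu> g *w Op (S_coeff g) w"
proof -
  have "s_op scaleW \<rho> g w = inverse (of_nat CARD('v)) *w (\<Sum>y\<in>UNIV. T (- g y) (T y w))"
    unfolding s_op_def \<rho> inv_T by (simp add: GL_def)
  thus ?thesis by (simp only: average_eq[OF assms])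
qed

text \<open>Multiplicativity of the normalised operators exhibits the scalar. Its uniqueness,
  required by the definite description, needs a vector not killed by s(gh).\<close>

lemma factor_set_eq:
  assumes g: "V.isometry g" and h: "V.isometry h" and "w\<^sub>0 \<noteq> (0::'w)"
  shows "factor_set scaleW \<rho> g h = \<mu> g * \<mu> h * inverse (\<mu> (h \<circ> g))"
proof -
  define c where "c = \<mu> g * \<mu> h * inverse (\<mu> (h \<circ> g))"
  have hg: "V.isometry (h \<circ> g)" by (rule V.isometry_comp[OF g h])
  note nz = \<mu>_nonzero[OF g] \<mu>_nonzero[OF h] \<mu>_nonzero[OF hg]
  have c: "c * \<mu> (h \<circ> g) = \<mu> g * \<mu> h"
    unfolding c_def using nz(3) by (metis mult.assoc left_inverse mult_1_right)
  have Op_scale: "Op a (r *w w) = r *w Op a w" for a r w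
    by (simp add: Op_def T_scale W.scale_sum_right mult.commute)
  have eq: "s_op scaleW \<rho> h (s_op scaleW \<rho> g w) = c *w s_op scaleW \<rho> (h \<circ> g) w" for w
    unfolding s_op_eq[OF g] s_op_eq[OF h] s_op_eq[OF hg] Op_scale Op_S_coeff_comp[OF h g]
    by (simp only: W.scale_scale c mult.commute[of "\<mu> h"])
  \<comment> \<open>The operator of the inverse isometry undoes
    \<open>Op (S_coeff (h \<circ> g))\<close>, which therefore does not kill
    \<open>w\<^sub>0\<close>.\<close>
  obtain k where k: "V.isometry k" "k \<circ> (h \<circ> g) = id" using V.isometry_inverse_exists[OF hg] .
  have "Op (S_coeff k) (Op (S_coeff (h \<circ> g)) w\<^sub>0) = w\<^sub>0"
    by (simp only: Op_S_coeff_comp[OF k(1) hg] k(2) Op_S_coeff_id)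
  moreover have "Op (S_coeff k) 0 = 0" using Op_scale[of "S_coeff k" 0 0] by simp
  ultimately have "Op (S_coeff (h \<circ> g)) w\<^sub>0 \<noteq> 0" using \<open>w\<^sub>0 \<noteq> 0\<close> by metis
  hence nz_op: "s_op scaleW \<rho> (h \<circ> g) w\<^sub>0 \<noteq> 0" using nz(3) by (simp add: s_op_eq[OF hg])
  show ?thesis
    unfolding factor_set_def c_def[symmetric]
  proof (rule the_equality)
    show "c \<noteq> 0 \<and> s_op scaleW \<rho> h \<circ> s_op scaleW \<rho> g = (\<lambda>w. c *w s_op scaleW \<rho> (h \<circ> g) w)"
      using eq nz by (auto simp: fun_eq_iff c_def)
  next
    fix d
    assume "d \<noteq> 0 \<and> s_op scaleW \<rho> h \<circ> s_op scaleW \<rho> g = (\<lambda>w. d *w s_op scaleW \<rho> (h \<circ> g) w)"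
    hence "d *w s_op scaleW \<rho> (h \<circ> g) w\<^sub>0 = c *w s_op scaleW \<rho> (h \<circ> g) w\<^sub>0"
      using eq[of w\<^sub>0] by (metis comp_apply)
    thus "d = c" using nz_op by simp
  qed
qed

end

text \<open>\<open>\<eta>\<close> sends \<open>e a\<close> to \<open>e (- a)\<close>, so it
  multiplies \<theta> by the sign of -1. Passing to the inverse multiplies \<open>I_disc\<close> by
  the same sign to the power of the dimension, and the two cancel.\<close>

lemma \<mu>_automorphism:
  assumes \<eta>: "field_isom \<eta>" "\<eta> \<epsilon> = inverse \<epsilon>"
    and g: "V.isometry g" and g': "V.isometry g'" "g' \<circ> g = id" "g \<circ> g' = id"
  shows "\<eta> (\<mu> g') = \<mu> g"
proof -
  interpret \<eta>: field_isom \<eta> by (rule \<eta>(1))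
  let ?\<chi> = "of_int (quadratic_char (- 1 :: 'p mod_ring)) :: 'k"
  have e: "\<eta> (e a) = e (- a)" for a
  proof -
    have "\<eta> (e a) = inverse (e a)"
      by (simp only: e_def \<eta>.hom_power \<eta>(2) power_inverse)
    thus ?thesis by (simp only: e_minus)
  qed
  have "\<eta> \<theta> = (\<Sum>a\<in>UNIV. e (- 1 * a\<^sup>2))"
    by (simp add: gauss_sum_eq \<eta>.hom_sum e)
  hence \<theta>: "\<eta> \<theta> = ?\<chi> * \<theta>"
    using gauss_sum_scaled[of "- 1"] by simp
  have sq: "?\<chi> * ?\<chi> = 1" by (simp only: of_int_mult[symmetric] quadratic_char_times_self of_int_1)
  let ?n = "V.dim (I_space g)"
  have "\<eta> (\<mu> g') = inverse (of_nat (card (I_space g))) * (?\<chi> * \<theta>) ^ ?n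
      * (?\<chi> ^ ?n * of_int (I_disc scaleV f g))"
    by (simp add: \<mu>_fun_def \<theta>_def[symmetric] I_space_inverse[OF g g'] I_disc_inverse[OF g g']
        hom_distribs \<theta>)
  also have "\<dots> = (?\<chi> * ?\<chi>) ^ ?n * \<mu> g"
    by (simp add: \<mu>_fun_def \<theta>_def power_mult_distrib mult_ac)
  finally show ?thesis by (simp only: sq power_one mult_1)
qed

end

section \<open>From the representation to the operators, and the conclusion\<close>

lemma finite_UNIV_of_dim:
  fixes scale :: "'k::{field,finite} \<Rightarrow> 'v::ab_group_add \<Rightarrow> 'v"
  assumes "vector_space scale" and "vector_space.dim scale (UNIV :: 'v set) > 0"
  shows "finite (UNIV :: 'v set)"
proof -
  interpret vector_space scale by (rule assms(1))
  obtain B where B: "UNIV \<subseteq> span B" "card B = dim UNIV" by (rule basis_exists)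
  \<comment> \<open>Infinite sets have \<open>card\<close> 0, so positive dimension forces a finite
    basis.\<close>
  have "finite B" using B assms(2) by (metis card.infinite less_irrefl)
  have "span B \<subseteq> (\<lambda>c. \<Sum>b\<in>B. scale (c b) b) ` (B \<rightarrow>\<^sub>E UNIV)"
  proof
    fix x assume "x \<in> span B"
    then obtain u where u: "x = (\<Sum>b\<in>B. scale (u b) b)"
      unfolding span_finite[OF \<open>finite B\<close>] by blast
    have "x = (\<Sum>b\<in>B. scale (restrict u B b) b)"
      unfolding u by (rule sum.cong) simp_all
    moreover have "restrict u B \<in> B \<rightarrow>\<^sub>E UNIV" by simp
    ultimately show "x \<in> (\<lambda>c. \<Sum>b\<in>B. scale (c b) b) ` (B \<rightarrow>\<^sub>E UNIV)" by (rule image_eqI)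
  qed
  moreover have "finite (B \<rightarrow>\<^sub>E (UNIV :: 'k set))" using \<open>finite B\<close> by (intro finite_PiE) auto
  ultimately show ?thesis using B(1) by (meson finite_imageI finite_subset)
qed

text \<open>Powers of the central element show that \<open>\<rho> (0, a)\<close> is the scalar
  \<open>e a\<close>. Factoring \<open>(x + y, f x y)\<close> as \<open>(x + y, 0)\<close> times
  \<open>(0, f x y)\<close> then gives the law for \<open>T\<close>.\<close>

lemma heisenberg_operators_of_hom:
  fixes scaleV :: "'p::prime_card mod_ring \<Rightarrow> 'v::ab_group_add \<Rightarrow> 'v"
    and scaleW :: "'k::field \<Rightarrow> 'w::ab_group_add \<Rightarrow> 'w"
  assumes V: "symplectic scaleV f" and W: "vector_space scaleW"
    and char: "primitive_character TYPE('p) \<epsilon>"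
    and hom: "\<rho> \<in> hom (extraspecial f) (GL scaleW)"
    and center: "\<rho> (0, 1) = (\<lambda>w. scaleW \<epsilon> w)"
  shows "heisenberg_operators scaleV f \<epsilon> scaleW (\<lambda>x. \<rho> (x, 0))"
proof -
  interpret V: symplectic scaleV f by (rule V)
  interpret W: vector_space scaleW by (rule W)
  interpret primitive_character \<epsilon> "TYPE('p)" by (rule char)
  have mult: "\<rho> (x + y, a + b + f x y) = \<rho> (y, b) \<circ> \<rho> (x, a)" for x y a b
    using hom_mult[OF hom, of "(x, a)" "(y, b)"] by (simp add: extraspecial_def GL_def)
  have GL: "\<rho> x \<in> carrier (GL scaleW)" for x
    using hom by (auto simp: hom_def extraspecial_def)
  have zero: "\<rho> (0, 0) = id"
  proof
    fix w
    have "\<rho> (0, 0) (\<rho> (0, 0) w) = \<rho> (0, 0) w"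
      using fun_cong[OF mult[of 0 0 0 0], of w] by simp
    \<comment> \<open>An injective idempotent is the identity.\<close>
    moreover have "inj (\<rho> (0, 0))" using GL[of "(0, 0)"] by (simp add: GL_def bij_is_inj)
    ultimately show "\<rho> (0, 0) w = id w" by (simp add: inj_eq)
  qed
  have "\<rho> (0, of_nat n) w = scaleW (\<epsilon> ^ n) w" for n w
  proof (induction n)
    case (Suc n)
    thus ?case using fun_cong[OF mult[of 0 0 "of_nat n" 1], of w] by (simp add: center add.commute)
  qed (simp add: zero)
  hence scalar: "\<rho> (0, a) w = scaleW (e a) w" for a w
    unfolding e_def
    by (metis of_int_of_int_mod_ring of_int_mod_ring_to_int_mod_ring of_nat_nat to_int_mod_ring_bounds(1))
  show ?thesis
  proof (intro heisenberg_operators.intro heisenberg_operators_axioms.intro V W char)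
    fix x y w
    show "Vector_Spaces.linear scaleW scaleW (\<rho> (x, 0))" using GL by (simp add: GL_def)
    show "\<rho> (0, 0) w = w" by (simp add: zero)
    have "\<rho> (y, 0) (\<rho> (x, 0) w) = \<rho> (x + y, f x y) w"
      using fun_cong[OF mult[of x y 0 0], of w] by simp
    also have "\<dots> = scaleW (e (f x y)) (\<rho> (x + y, 0) w)"
      using fun_cong[OF mult[of "x + y" 0 0 "f x y"], of w] by (simp add: scalar)
    finally show "\<rho> (y, 0) (\<rho> (x, 0) w) = scaleW (e (f x y)) (\<rho> (x + y, 0) w)" .
  qed
qed

theorem theorem6p5:
  fixes p n :: nat
    and scaleV :: "'p::prime_card mod_ring \<Rightarrow> 'v::ab_group_add \<Rightarrow> 'v"
    and f :: "'v \<Rightarrow> 'v \<Rightarrow> 'p mod_ring"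
    and scaleW :: "'k::field \<Rightarrow> 'w::ab_group_add \<Rightarrow> 'w"
    and \<rho> :: "'v \<times> 'p mod_ring \<Rightarrow> 'w \<Rightarrow> 'w"
    and \<epsilon> :: 'k
  assumes "p = CARD('p)" and "odd p" and "n \<ge> 1"
    and "vector_space scaleV" and "vector_space.dim scaleV (UNIV :: 'v set) = 2 * n"
    and "symplectic_form scaleV f"
    and "vector_space scaleW" and "vector_space.dim scaleW (UNIV :: 'w set) = p ^ n"
    and "\<rho> \<in> hom (extraspecial f) (GL scaleW)"
    and "absolutely_irreducible scaleW (extraspecial f) \<rho>"
    and "\<rho> (0, 1) = (\<lambda>w. scaleW \<epsilon> w)" and "primitive_root_of_unity p \<epsilon>"
  shows "splits (Sp scaleV f) (\<mu>_fun scaleV f \<epsilon>) (factor_set scaleW \<rho>) \<and>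
    (\<forall>\<eta>. field_isom \<eta> \<and> \<eta> \<epsilon> = inverse \<epsilon> \<longrightarrow>
       (\<forall>g\<in>carrier (Sp scaleV f).
          \<mu>_fun scaleV f \<epsilon> g = \<eta> (\<mu>_fun scaleV f \<epsilon> (inv\<^bsub>Sp scaleV f\<^esub> g))))"
proof -
  have "finite (UNIV :: 'v set)"
    using finite_UNIV_of_dim[OF assms(4)] assms(3,5) by simp
  then interpret V: symplectic scaleV f
    using assms(1,2,4,6) two_neq_zero_mod_ring[where 'p='p]
    by (intro symplectic.intro finite_space.intro finite_space_axioms.intro symplectic_axioms.intro) auto
  have "primitive_character TYPE('p) \<epsilon>"
    using assms(1,2,12) by (simp add: primitive_character_def)
  then interpret heisenberg_operators scaleV f \<epsilon> "TYPE('p)" scaleW "\<lambda>x. \<rho> (x, 0)"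
    by (rule heisenberg_operators_of_hom[OF V.symplectic_axioms assms(7) _ assms(9,11)])
  \<comment> \<open>The dimension \<open>p ^ n\<close> is positive, so the space is not
    zero.\<close>
  have "\<exists>w :: 'w. w \<noteq> 0"
  proof (rule ccontr)
    assume "\<nexists>w :: 'w. w \<noteq> 0"
    hence "(UNIV :: 'w set) = {0}" by auto
    hence "W.dim (UNIV :: 'w set) = 0" using W.dim_le_card[of "UNIV :: 'w set" "{}"] by simp
    thus False using assms(1,8) by simp
  qed
  then obtain w\<^sub>0 :: 'w where w\<^sub>0: "w\<^sub>0 \<noteq> 0" ..
  have "splits (Sp scaleV f) (\<mu>_fun scaleV f \<epsilon>) (factor_set scaleW \<rho>)"
    unfolding splits_def V.carrier_Sp V.mult_Sp
    using \<mu>_nonzero factor_set_eq[OF refl _ _ w\<^sub>0] by blast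
  moreover have "\<mu> g = \<eta> (\<mu> (inv\<^bsub>Sp scaleV f\<^esub> g))"
    if "field_isom \<eta>" "\<eta> \<epsilon> = inverse \<epsilon>" "V.isometry g" for \<eta> g
    using V.isometry_inverse_exists[OF that(3)] \<mu>_automorphism[OF that] by metis
  ultimately show ?thesis by (auto simp: V.carrier_Sp)
qed

end
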